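(* Let $h\in\mathcal{K}$ with $h(0)=1$. Then $$\sum_{z\in\mathcal{Z}(h)}\left(|z|^{-1}-1\right)\leq \|Bh\|_{\mathcal{K}},$$ where each zero is counted according to its order.
   Context: $\mathbb{D}$ is the open unit disk in $\mathbb{C}$, $\mathbb{T}$ the unit circle, and $H(\mathbb{D})$ the space of holomorphic functions on $\mathbb{D}$. Let $\mathcal{M}$ be the set of all finite complex Borel measures on $\mathbb{T}$, with $\|\mu\|$ the total variation of $\mu\in\mathcal{M}$. The Cauchy transform of $\mu\in\mathcal{M}$ is the function $K\mu\in H(\mathbb{D})$, $$(K\mu)(w)=\int_{\mathbb{T}}\frac{\mu(d\zeta)}{1-w\overline{\zeta}},\qquad w\in\mathbb{D}.$$ $\mathcal{K}=\{h\in H(\mathbb{D}): h=K\mu \text{ for some }\mu\in\mathcal{M}\}$ is the space of Cauchy transforms, normed by $\|h\|_{\mathcal{K}}=\inf\{\|\mu\|:\mu\in\mathcal{M},\ K\mu=h\}$. The backward shift $B$ on $H(\mathbb{D})$ is $(Bh)(w)=\frac{h(w)-h(0)}{w}$ for $w\in\mathbb{D}$ (with the removable singularity at $w=0$ filled in); for $h\in\mathcal{K}$ one has $Bh\in\mathcal{K}$. $\mathcal{Z}(h)$ is the set of zeros of $h$ in $\mathbb{D}$; the sum counts each zero as many times as its order. *)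

theory Defs
  imports "HOL-Complex_Analysis.Complex_Analysis"
begin

text \<open>
  A complex measure is a countably additive complex-valued set function; the measure space
  \<open>M\<close> supplies only the underlying set and sigma-algebra. Values of \<open>\<mu>\<close> outside \<open>sets M\<close> are
  irrelevant to all notions below. Finiteness of the total variation is automatic.
\<close>

definition complex_measure :: "'a measure \<Rightarrow> ('a set \<Rightarrow> complex) \<Rightarrow> bool" where
  "complex_measure M \<mu> \<longleftrightarrow>
     (\<forall>A :: nat \<Rightarrow> 'a set. range A \<subseteq> sets M \<longrightarrow> disjoint_family A \<longrightarrow>
        (\<lambda>n. \<mu> (A n)) sums \<mu> (\<Union>n. A n))"

definition total_variation :: "'a measure \<Rightarrow> ('a set \<Rightarrow> complex) \<Rightarrow> ennreal" where
  "total_variation M \<mu> =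
     (SUP P \<in> {P. finite P \<and> P \<subseteq> sets M \<and> partition_on (space M) P}.
        \<Sum>A\<in>P. ennreal (norm (\<mu> A)))"

text \<open>
  The upper variation (positive part) of a signed measure \<open>\<nu>\<close>. Since \<open>\<nu> {} = 0\<close>, truncation of
  negative values by \<open>ennreal\<close> does not affect the supremum. The lower variation of \<open>\<nu>\<close> is the
  upper variation of \<open>- \<nu>\<close>, and \<open>\<nu>\<close> is their difference (Jordan decomposition).
\<close>

definition upper_variation :: "'a measure \<Rightarrow> ('a set \<Rightarrow> real) \<Rightarrow> 'a measure" where
  "upper_variation M \<nu> =
     measure_of (space M) (sets M) (\<lambda>A. SUP B \<in> {B \<in> sets M. B \<subseteq> A}. ennreal (\<nu> B))"

definition complex_measure_integral ::
  "'a measure \<Rightarrow> ('a set \<Rightarrow> complex) \<Rightarrow> ('a \<Rightarrow> complex) \<Rightarrow> complex" where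
  "complex_measure_integral M \<mu> f =
     (LINT x | upper_variation M (\<lambda>A. Re (\<mu> A)). f x)
     - (LINT x | upper_variation M (\<lambda>A. - Re (\<mu> A)). f x)
     + \<i> * ((LINT x | upper_variation M (\<lambda>A. Im (\<mu> A)). f x)
          - (LINT x | upper_variation M (\<lambda>A. - Im (\<mu> A)). f x))"

definition circle_borel :: "complex measure" where
  "circle_borel = restrict_space borel (sphere 0 1)"

definition cauchy_transform :: "(complex set \<Rightarrow> complex) \<Rightarrow> complex \<Rightarrow> complex" where
  "cauchy_transform \<mu> w = complex_measure_integral circle_borel \<mu> (\<lambda>\<zeta>. 1 / (1 - w * cnj \<zeta>))"

text \<open>
  Functions on the unit disk are total functions on \<open>complex\<close> considered only on \<open>ball 0 1\<close>.
\<close>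

definition representing_measures :: "(complex \<Rightarrow> complex) \<Rightarrow> (complex set \<Rightarrow> complex) set" where
  "representing_measures h =
     {\<mu>. complex_measure circle_borel \<mu> \<and> (\<forall>w\<in>ball 0 1. cauchy_transform \<mu> w = h w)}"

definition cauchy_transforms :: "(complex \<Rightarrow> complex) set" where
  "cauchy_transforms = {h. h holomorphic_on ball 0 1 \<and> representing_measures h \<noteq> {}}"

text \<open>
  The norm is valued in \<open>ennreal\<close>, so that it is infinite, rather than an unspecified real,
  for functions that are not Cauchy transforms.
\<close>

definition cauchy_norm :: "(complex \<Rightarrow> complex) \<Rightarrow> ennreal" where
  "cauchy_norm h = (INF \<mu> \<in> representing_measures h. total_variation circle_borel \<mu>)"

definition backward_shift :: "(complex \<Rightarrow> complex) \<Rightarrow> complex \<Rightarrow> complex" where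
  "backward_shift h w = (if w = 0 then deriv h 0 else (h w - h 0) / w)"

definition disk_zeros :: "(complex \<Rightarrow> complex) \<Rightarrow> complex set" where
  "disk_zeros h = {z \<in> ball 0 1. h z = 0}"

end

theory Submission
  imports Defs
begin

text \<open>
  Let \<open>\<nu>\<close> represent \<open>B h\<close>, so that \<open>h w = 1 + w * L (kernel w)\<close> with \<open>L f = \<integral> f d\<nu>\<close>. In \<open>L\<^sup>2(|\<nu>|)\<close> the
  operator \<open>T f = cnj \<zeta> * f - L f\<close> is a rank one perturbation of a unitary, and the inverse zeros of
  \<open>h\<close> are eigenvalues of \<open>T\<close>, with multiplicity. Triangularising \<open>T\<close> on the span of finitely many
  generalised eigenvectors by an orthonormal system \<open>e\<close> gives \<open>1 / z j = \<langle>T (e j), e j\<rangle>\<close>, hence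
  \<open>1 / |z j| - 1 \<le> |L (e j)| * |\<langle>1, e j\<rangle>|\<close>, and by the Cauchy--Schwarz and Bessel inequalities these
  products add up to at most \<open>|\<nu>|(sphere 0 1)\<close>, the total variation.
\<close>

section \<open>Countable additivity of variations\<close>

text \<open>Since \<open>cnj \<zeta> * kernel z = (kernel z - 1) / z\<close>, the function
  \<open>kernel z\<close> satisfies \<open>T f = f / z\<close> exactly when
  \<open>L (kernel z) = - 1 / z\<close>, that is, when \<open>h z = 0\<close>. In the diagonal
  entries, the subtracted 1 is the norm bound of the unitary part of \<open>T\<close>. The final
  bound is |\<nu>| with constant 1, whereas the integral is given through four Jordan parts, and
  estimating these separately would lose a factor. Hence the domination of \<open>L\<close> by
  |\<nu>| is proved on simple functions, where the parts recombine to \<nu>, and then extended by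
  limits. No quotient space is formed: the Hilbert space argument runs on continuous functions on
  the circle with a seminorm. The generalised eigenvectors must therefore be independent modulo null
  functions; this is read off from values of \<open>L\<close>, which vanishes on null functions. As
  \<nu> is any representing measure, the bound passes to the infimum.\<close>

definition partition_sup :: "'a measure \<Rightarrow> ('a set \<Rightarrow> ennreal) \<Rightarrow> 'a set \<Rightarrow> ennreal" where
  "partition_sup M g A =
     (SUP P \<in> {P. finite P \<and> P \<subseteq> sets M \<and> disjoint P \<and> \<Union>P \<subseteq> A}. \<Sum>B\<in>P. g B)"

text \<open>The hypothesis under which \<open>partition_sup M g\<close> is a measure. Two instances
  occur: the norm of a complex measure yields its variation, a signed measure truncated at 0 yields
  its upper variation. The families in \<open>partition_sup\<close> need not cover \<open>A\<close>,
  which makes monotonicity in \<open>A\<close> immediate.\<close>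

definition subadditive_on :: "'a measure \<Rightarrow> ('a set \<Rightarrow> ennreal) \<Rightarrow> bool" where
  "subadditive_on M g \<longleftrightarrow> g {} = 0 \<and>
     (\<forall>A :: nat \<Rightarrow> 'a set. range A \<subseteq> sets M \<longrightarrow> disjoint_family A \<longrightarrow>
        g (\<Union>n. A n) \<le> (\<Sum>n. g (A n)))"

lemma partition_sup_upper:
  assumes "finite P" "P \<subseteq> sets M" "disjoint P" "\<Union>P \<subseteq> A"
  shows "(\<Sum>B\<in>P. g B) \<le> partition_sup M g A"
  unfolding partition_sup_def by (rule SUP_upper) (use assms in auto)

lemma partition_sup_ge:
  assumes "A \<in> sets M"
  shows "g A \<le> partition_sup M g A"
  using partition_sup_upper[of "{A}" M A g] assms by simp

lemma partition_sup_mono: "A \<subseteq> B \<Longrightarrow> partition_sup M g A \<le> partition_sup M g B"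
  unfolding partition_sup_def by (intro SUP_subset_mono) auto

text \<open>Families inside \<open>A\<close> and inside \<open>B\<close> unite to a family inside
  \<open>A \<union> B\<close>. They can share only the empty set, so \<open>g {} = 0\<close> keeps
  the sum from losing a term.\<close>

lemma partition_sup_superadditive:
  assumes "g {} = 0" "A \<inter> B = {}"
  shows "partition_sup M g A + partition_sup M g B \<le> partition_sup M g (A \<union> B)"
proof -
  let ?S = "\<lambda>A. {P. finite P \<and> P \<subseteq> sets M \<and> disjoint P \<and> \<Union>P \<subseteq> A}"
  have ne: "?S A \<noteq> {}" for A
    by (auto intro!: exI[of _ "{}"])
  have 1: "sum g P + sum g Q \<le> partition_sup M g (A \<union> B)" if "P \<in> ?S A" "Q \<in> ?S B" for P Q
  proof -
    have sub: "P \<inter> Q \<subseteq> {{}}"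
      using that assms(2) by blast
    have "sum g P + sum g Q = sum g (P \<union> Q)"
      using that sub assms(1) by (intro sum.union_inter_neutral[symmetric]) auto
    also have "\<dots> \<le> partition_sup M g (A \<union> B)"
    proof (rule partition_sup_upper)
      show "disjoint (P \<union> Q)"
        using that assms(2) by (intro disjoint_union) blast+
    qed (use that in auto)
    finally show ?thesis .
  qed
  have "partition_sup M g A + partition_sup M g B
      = (SUP P\<in>?S A. sum g P + partition_sup M g B)"
    unfolding partition_sup_def[of M g A] using ne by (subst ennreal_SUP_add_left) auto
  also have "\<dots> = (SUP P\<in>?S A. SUP Q\<in>?S B. sum g P + sum g Q)"
    unfolding partition_sup_def[of M g B] using ne by (subst ennreal_SUP_add_right) auto
  also have "\<dots> \<le> partition_sup M g (A \<union> B)"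
    by (intro SUP_least 1)
  finally show ?thesis .
qed

lemma partition_sup_sum_le:
  fixes A :: "nat \<Rightarrow> 'a set"
  assumes "g {} = 0" "disjoint_family A"
  shows "(\<Sum>i<n. partition_sup M g (A i)) \<le> partition_sup M g (\<Union>i<n. A i)"
proof (induction n)
  case (Suc n)
  have "(\<Union>i<n. A i) \<inter> A n = {}"
  proof -
    have "A i \<inter> A n = {}" if "i < n" for i
      using that by (intro disjoint_family_onD[OF assms(2)]) auto
    then show ?thesis by blast
  qed
  from partition_sup_superadditive[of g, OF assms(1) this, of M] Suc
  have "(\<Sum>i<n. partition_sup M g (A i)) + partition_sup M g (A n)
      \<le> partition_sup M g ((\<Union>i<n. A i) \<union> A n)"
    by (meson add_right_mono order_trans)
  also have "(\<Union>i<n. A i) \<union> A n = (\<Union>i<Suc n. A i)"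
    by (auto simp: lessThan_Suc)
  finally show ?case by simp
qed simp

text \<open>One direction is superadditivity on finite unions. For the other, each member of a
  finite family is cut along all the \<open>A i\<close>; countable subadditivity of \<open>g\<close>
  and an exchange of sums give the bound.\<close>

lemma partition_sup_suminf:
  fixes A :: "nat \<Rightarrow> 'a set"
  assumes g: "subadditive_on M g" and A: "range A \<subseteq> sets M" "disjoint_family A"
  shows "(\<Sum>i. partition_sup M g (A i)) = partition_sup M g (\<Union>i. A i)"
proof (rule antisym)
  have g0: "g {} = 0"
    using g by (simp add: subadditive_on_def)
  show "(\<Sum>i. partition_sup M g (A i)) \<le> partition_sup M g (\<Union>i. A i)"
  proof (rule suminf_le_const)
    show "(\<Sum>i<n. partition_sup M g (A i)) \<le> partition_sup M g (\<Union>i. A i)" for n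
      by (rule order_trans[OF partition_sup_sum_le[of g, OF g0 A(2)] partition_sup_mono]) auto
  qed simp
  show "partition_sup M g (\<Union>i. A i) \<le> (\<Sum>i. partition_sup M g (A i))"
    unfolding partition_sup_def[of M g "\<Union>i. A i"]
  proof (rule SUP_least, clarify)
    fix P assume P: "finite P" "P \<subseteq> sets M" "disjoint P" "\<Union>P \<subseteq> (\<Union>i. A i)"
    have "sum g P \<le> (\<Sum>B\<in>P. \<Sum>i. g (B \<inter> A i))"
    proof (rule sum_mono)
      fix B assume B: "B \<in> P"
      have "B = (\<Union>i. B \<inter> A i)"
        using P(4) B by auto
      moreover have "g (\<Union>i. B \<inter> A i) \<le> (\<Sum>i. g (B \<inter> A i))"
      proof -
        have "range (\<lambda>i. B \<inter> A i) \<subseteq> sets M"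
          using P(2) A(1) B by blast
        moreover have "disjoint_family (\<lambda>i. B \<inter> A i)"
          using A(2) unfolding disjoint_family_on_def by blast
        ultimately show ?thesis
          using g unfolding subadditive_on_def by blast
      qed
      ultimately show "g B \<le> (\<Sum>i. g (B \<inter> A i))"
        by simp
    qed
    also have "\<dots> = (\<Sum>i. \<Sum>B\<in>P. g (B \<inter> A i))"
      by (rule suminf_sum[symmetric]) simp
    also have "\<dots> \<le> (\<Sum>i. partition_sup M g (A i))"
    proof (rule suminf_le)
      fix i
      \<comment> \<open>Different members of \<open>P\<close> may have equal traces on
        \<open>A i\<close>, but being disjoint they then have empty trace, where \<open>g\<close> is
        0.\<close>
      have "(\<Sum>B\<in>P. g (B \<inter> A i)) = sum g ((\<lambda>B. B \<inter> A i) ` P)"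
      proof (subst sum.reindex_nontrivial)
        fix B C assume BC: "B \<in> P" "C \<in> P" "B \<noteq> C" "B \<inter> A i = C \<inter> A i"
        then have "B \<inter> C = {}"
          using P(3) by (auto simp: disjoint_def)
        with BC(4) have "B \<inter> A i = {}" by blast
        then show "g (B \<inter> A i) = 0"
          using g0 by simp
      qed (use P in auto)
      also have "\<dots> \<le> partition_sup M g (A i)"
      proof (rule partition_sup_upper)
        show "disjoint ((\<lambda>B. B \<inter> A i) ` P)"
          using P(3) unfolding disjoint_def by blast
        show "(\<lambda>B. B \<inter> A i) ` P \<subseteq> sets M"
          using P(2) A(1) by blast
      qed (use P in auto)
      finally show "(\<Sum>B\<in>P. g (B \<inter> A i)) \<le> partition_sup M g (A i)" .
    qed auto
    finally show "sum g P \<le> (\<Sum>i. partition_sup M g (A i))" .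
  qed
qed

lemma partition_sup_empty:
  assumes "g {} = 0"
  shows "partition_sup M g {} = 0"
proof -
  have "sum g P = 0" if "\<Union>P \<subseteq> {}" for P
    using that assms by (intro sum.neutral) auto
  then show ?thesis
    unfolding partition_sup_def by (intro antisym SUP_least) auto
qed

lemma emeasure_partition_sup:
  assumes g: "subadditive_on M g" and A: "A \<in> sets M"
  shows "emeasure (measure_of (space M) (sets M) (partition_sup M g)) A = partition_sup M g A"
proof (rule emeasure_measure_of_sigma)
  show "sigma_algebra (space M) (sets M)" ..
  show "positive (sets M) (partition_sup M g)"
    using g by (simp add: positive_def partition_sup_empty subadditive_on_def)
  show "countably_additive (sets M) (partition_sup M g)"
    unfolding countably_additive_def using partition_sup_suminf[OF g] by blast
qed (fact A)

lemma norm_sums_le_suminf: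
  fixes f :: "nat \<Rightarrow> 'a :: real_normed_vector"
  assumes "f sums s"
  shows "ennreal (norm s) \<le> (\<Sum>i. ennreal (norm (f i)))"
proof (rule LIMSEQ_le_const2)
  show "(\<lambda>n. ennreal (norm (\<Sum>i<n. f i))) \<longlonglongrightarrow> ennreal (norm s)"
    using assms unfolding sums_def by (intro tendsto_ennrealI tendsto_norm)
  have "ennreal (norm (\<Sum>i<n. f i)) \<le> (\<Sum>i. ennreal (norm (f i)))" for n
  proof -
    have "ennreal (norm (\<Sum>i<n. f i)) \<le> ennreal (\<Sum>i<n. norm (f i))"
      by (intro ennreal_leI norm_sum)
    also have "\<dots> = (\<Sum>i<n. ennreal (norm (f i)))"
      by simp
    also have "\<dots> \<le> (\<Sum>i. ennreal (norm (f i)))"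
      by (intro sum_le_suminf) auto
    finally show ?thesis .
  qed
  then show "\<exists>N. \<forall>n\<ge>N. ennreal (norm (\<Sum>i<n. f i)) \<le> (\<Sum>i. ennreal (norm (f i)))"
    by blast
qed

lemma sums_le_suminf_pos:
  fixes f :: "nat \<Rightarrow> real"
  assumes "f sums s"
  shows "ennreal s \<le> (\<Sum>i. ennreal (f i))"
proof (rule LIMSEQ_le_const2)
  show "(\<lambda>n. ennreal (\<Sum>i<n. f i)) \<longlonglongrightarrow> ennreal s"
    using assms unfolding sums_def by (intro tendsto_ennrealI)
  have "ennreal (\<Sum>i<n. f i) \<le> (\<Sum>i. ennreal (f i))" for n
  proof -
    have "ennreal (\<Sum>i<n. f i) \<le> ennreal (\<Sum>i<n. max 0 (f i))"
      by (intro ennreal_leI sum_mono) auto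
    also have "\<dots> = (\<Sum>i<n. ennreal (f i))"
      by (subst sum_ennreal[symmetric])
        (auto intro!: sum.cong simp: max_def ennreal_neg simp del: sum_ennreal)
    also have "\<dots> \<le> (\<Sum>i. ennreal (f i))"
      by (intro sum_le_suminf) auto
    finally show ?thesis .
  qed
  then show "\<exists>N. \<forall>n\<ge>N. ennreal (\<Sum>i<n. f i) \<le> (\<Sum>i. ennreal (f i))"
    by blast
qed

section \<open>Signed and complex measures and their variations\<close>

definition signed_measure :: "'a measure \<Rightarrow> ('a set \<Rightarrow> real) \<Rightarrow> bool" where
  "signed_measure M \<nu> \<longleftrightarrow>
     (\<forall>A :: nat \<Rightarrow> 'a set. range A \<subseteq> sets M \<longrightarrow> disjoint_family A \<longrightarrow>
        (\<lambda>n. \<nu> (A n)) sums \<nu> (\<Union>n. A n))"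

lemma complex_measure_empty:
  assumes "complex_measure M \<mu>"
  shows "\<mu> {} = 0"
proof -
  have "(\<lambda>n::nat. \<mu> {}) sums \<mu> (\<Union>n::nat. {})"
    using assms unfolding complex_measure_def
    by (elim allE[of _ "\<lambda>_. {}"]) (auto simp: disjoint_family_on_def)
  then have "summable (\<lambda>n::nat. \<mu> {})"
    by (auto simp: sums_iff)
  then show ?thesis
    using summable_LIMSEQ_zero LIMSEQ_const_iff by blast
qed

lemma complex_measure_Un:
  assumes \<mu>: "complex_measure M \<mu>" and "A \<in> sets M" "B \<in> sets M" "A \<inter> B = {}"
  shows "\<mu> (A \<union> B) = \<mu> A + \<mu> B"
proof -
  let ?A = "binaryset A B"
  have "(\<lambda>n. \<mu> (?A n)) sums \<mu> (\<Union>n. ?A n)"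
  proof -
    have "range ?A \<subseteq> sets M" "disjoint_family ?A"
      using assms(2-4) by (auto simp: disjoint_family_on_def binaryset_def)
    then show ?thesis
      using \<mu> unfolding complex_measure_def by blast
  qed
  moreover have "(\<lambda>n. \<mu> (?A n)) sums (\<mu> A + \<mu> B)"
    using complex_measure_empty[OF \<mu>] by (intro binaryset_sums)
  ultimately show ?thesis
    by (simp add: UN_binaryset_eq sums_unique2)
qed

lemma complex_measure_of_real_iff:
  "complex_measure M (\<lambda>A. complex_of_real (\<nu> A)) \<longleftrightarrow> signed_measure M \<nu>"
  by (simp add: complex_measure_def signed_measure_def sums_of_real_iff)

lemma signed_measure_empty: "signed_measure M \<nu> \<Longrightarrow> \<nu> {} = 0"
  using complex_measure_empty[of M "\<lambda>A. complex_of_real (\<nu> A)"]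
  by (simp add: complex_measure_of_real_iff)

lemma signed_measure_Un:
  assumes "signed_measure M \<nu>" "A \<in> sets M" "B \<in> sets M" "A \<inter> B = {}"
  shows "\<nu> (A \<union> B) = \<nu> A + \<nu> B"
proof -
  have "complex_of_real (\<nu> (A \<union> B)) = complex_of_real (\<nu> A + \<nu> B)"
    using complex_measure_Un[of M "\<lambda>A. complex_of_real (\<nu> A)" A B] assms
    by (simp add: complex_measure_of_real_iff)
  then show ?thesis
    by (simp only: of_real_eq_iff)
qed

lemma signed_measure_minus: "signed_measure M \<nu> \<Longrightarrow> signed_measure M (\<lambda>A. - \<nu> A)"
  by (auto simp: signed_measure_def intro!: sums_minus)

lemma signed_measure_Re: "complex_measure M \<mu> \<Longrightarrow> signed_measure M (\<lambda>A. Re (\<mu> A))"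
  by (auto simp: signed_measure_def complex_measure_def intro!: sums_Re)

lemma signed_measure_Im: "complex_measure M \<mu> \<Longrightarrow> signed_measure M (\<lambda>A. Im (\<mu> A))"
  by (auto simp: signed_measure_def complex_measure_def intro!: sums_Im)

lemma signed_measure_Union:
  assumes \<nu>: "signed_measure M \<nu>" and "finite P" "P \<subseteq> sets M" "disjoint P"
  shows "\<nu> (\<Union>P) = (\<Sum>B\<in>P. \<nu> B)"
  using assms(2-)
proof (induction P rule: finite_induct)
  case empty
  then show ?case using signed_measure_empty[OF \<nu>] by simp
next
  case (insert B P)
  have "B \<inter> \<Union>P = {}"
    using insert.prems insert.hyps by (auto simp: disjoint_def)
  moreover have "\<Union>P \<in> sets M"
    using insert.prems insert.hyps by (intro sets.finite_Union) auto
  moreover have "disjoint P"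
    using insert.prems by (simp add: disjoint_def)
  ultimately show ?case
    using insert signed_measure_Un[OF \<nu>, of B "\<Union>P"] by simp
qed

lemma subadditive_on_norm:
  assumes "complex_measure M \<mu>"
  shows "subadditive_on M (\<lambda>A. ennreal (norm (\<mu> A)))"
  using assms complex_measure_empty[OF assms]
  by (auto simp: subadditive_on_def complex_measure_def intro!: norm_sums_le_suminf)

lemma subadditive_on_pos:
  assumes "signed_measure M \<nu>"
  shows "subadditive_on M (\<lambda>A. ennreal (\<nu> A))"
  using assms signed_measure_empty[OF assms]
  by (auto simp: subadditive_on_def signed_measure_def intro!: sums_le_suminf_pos)

text \<open>A finite family contributes only through its members of positive value, and additivity
  merges those into one subset. So the upper variation, defined by single subsets, falls under the
  result on \<open>partition_sup\<close>.\<close>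

lemma SUP_subsets_eq_partition_sup:
  assumes \<nu>: "signed_measure M \<nu>"
  shows "(SUP B \<in> {B \<in> sets M. B \<subseteq> A}. ennreal (\<nu> B)) = partition_sup M (\<lambda>A. ennreal (\<nu> A)) A"
proof (rule antisym)
  show "(SUP B \<in> {B \<in> sets M. B \<subseteq> A}. ennreal (\<nu> B)) \<le> partition_sup M (\<lambda>A. ennreal (\<nu> A)) A"
  proof (rule SUP_least, clarify)
    fix B assume "B \<in> sets M" "B \<subseteq> A"
    then show "ennreal (\<nu> B) \<le> partition_sup M (\<lambda>A. ennreal (\<nu> A)) A"
      using partition_sup_ge partition_sup_mono order_trans by metis
  qed
  show "partition_sup M (\<lambda>A. ennreal (\<nu> A)) A \<le> (SUP B \<in> {B \<in> sets M. B \<subseteq> A}. ennreal (\<nu> B))"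
    unfolding partition_sup_def
  proof (rule SUP_least, clarify)
    fix P assume P: "finite P" "P \<subseteq> sets M" "disjoint P" "\<Union>P \<subseteq> A"
    let ?Q = "{B \<in> P. \<nu> B > 0}"
    have "(\<Sum>B\<in>P. ennreal (\<nu> B)) = (\<Sum>B\<in>?Q. ennreal (\<nu> B))"
      using P(1) by (intro sum.mono_neutral_right) (auto simp: ennreal_eq_0_iff)
    also have "\<dots> = ennreal (\<Sum>B\<in>?Q. \<nu> B)"
      by (rule sum_ennreal) auto
    also have "(\<Sum>B\<in>?Q. \<nu> B) = \<nu> (\<Union>?Q)"
      using P by (intro signed_measure_Union[OF \<nu>, symmetric]) (auto simp: disjoint_def)
    also have "ennreal (\<nu> (\<Union>?Q)) \<le> (SUP B \<in> {B \<in> sets M. B \<subseteq> A}. ennreal (\<nu> B))"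
    proof (rule SUP_upper)
      show "\<Union>?Q \<in> {B \<in> sets M. B \<subseteq> A}"
        using P by (auto intro!: sets.finite_Union)
    qed
    finally show "(\<Sum>B\<in>P. ennreal (\<nu> B)) \<le> (SUP B \<in> {B \<in> sets M. B \<subseteq> A}. ennreal (\<nu> B))" .
  qed
qed

lemma sets_upper_variation [simp, measurable_cong]: "sets (upper_variation M \<nu>) = sets M"
  by (simp add: upper_variation_def sets.sigma_sets_eq)

lemma space_upper_variation [simp]: "space (upper_variation M \<nu>) = space M"
  by (simp add: upper_variation_def)

lemma emeasure_upper_variation:
  assumes \<nu>: "signed_measure M \<nu>" and A: "A \<in> sets M"
  shows "emeasure (upper_variation M \<nu>) A = (SUP B \<in> {B \<in> sets M. B \<subseteq> A}. ennreal (\<nu> B))"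
  unfolding upper_variation_def SUP_subsets_eq_partition_sup[OF \<nu>]
  by (rule emeasure_partition_sup[OF subadditive_on_pos[OF \<nu>] A])

definition variation_measure :: "'a measure \<Rightarrow> ('a set \<Rightarrow> complex) \<Rightarrow> 'a measure" where
  "variation_measure M \<mu> =
     measure_of (space M) (sets M) (partition_sup M (\<lambda>A. ennreal (norm (\<mu> A))))"

lemma sets_variation_measure [simp, measurable_cong]: "sets (variation_measure M \<mu>) = sets M"
  by (simp add: variation_measure_def sets.sigma_sets_eq)

lemma space_variation_measure [simp]: "space (variation_measure M \<mu>) = space M"
  by (simp add: variation_measure_def)

lemma emeasure_variation_measure:
  assumes "complex_measure M \<mu>" "A \<in> sets M"
  shows "emeasure (variation_measure M \<mu>) A = partition_sup M (\<lambda>A. ennreal (norm (\<mu> A))) A"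
  unfolding variation_measure_def
  by (rule emeasure_partition_sup[OF subadditive_on_norm[OF assms(1)] assms(2)])

lemma norm_le_variation_measure:
  assumes "complex_measure M \<mu>" "A \<in> sets M"
  shows "ennreal (norm (\<mu> A)) \<le> emeasure (variation_measure M \<mu>) A"
  using partition_sup_ge[OF assms(2), of "\<lambda>A. ennreal (norm (\<mu> A))"]
  by (simp add: emeasure_variation_measure[OF assms])

lemma variation_measure_space_le:
  assumes \<mu>: "complex_measure M \<mu>"
  shows "emeasure (variation_measure M \<mu>) (space M) \<le> total_variation M \<mu>"
  unfolding emeasure_variation_measure[OF \<mu> sets.top] partition_sup_def
proof (rule SUP_least, clarify)
  fix P assume P: "finite P" "P \<subseteq> sets M" "disjoint P" "\<Union>P \<subseteq> space M"
  \<comment> \<open>The complement completes \<open>P\<close> to a cover of the space. The empty set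
    is dropped because blocks of \<open>partition_on\<close> are nonempty; this costs nothing, as
    \<open>\<mu> {} = 0\<close>.\<close>
  let ?Q = "insert (space M - \<Union>P) P"
  have "(\<Sum>B\<in>P. ennreal (norm (\<mu> B))) = (\<Sum>B\<in>P - {{}}. ennreal (norm (\<mu> B)))"
    using P(1) complex_measure_empty[OF \<mu>] by (intro sum.mono_neutral_right) auto
  also have "\<dots> \<le> (\<Sum>B\<in>?Q - {{}}. ennreal (norm (\<mu> B)))"
    using P(1) by (intro sum_mono2) auto
  also have "\<dots> \<le> total_variation M \<mu>"
    unfolding total_variation_def
  proof (rule SUP_upper)
    have "\<Union>P \<in> sets M"
      using P by (intro sets.finite_Union) auto
    moreover have "disjoint ?Q"
      using P(3) by (auto simp: disjoint_def)
    then have "disjoint (?Q - {{}})"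
      by (rule pairwise_subset) blast
    ultimately show "?Q - {{}} \<in> {P. finite P \<and> P \<subseteq> sets M \<and> partition_on (space M) P}"
      using P(1,2,4) by (simp add: partition_on_def) blast
  qed
  finally show "(\<Sum>B\<in>P. ennreal (norm (\<mu> B))) \<le> total_variation M \<mu>" .
qed

lemma upper_variation_le_variation_measure:
  assumes "complex_measure M \<mu>" "signed_measure M \<nu>" "\<And>A. \<bar>\<nu> A\<bar> \<le> norm (\<mu> A)"
    and A: "A \<in> sets M"
  shows "emeasure (upper_variation M \<nu>) A \<le> emeasure (variation_measure M \<mu>) A"
  unfolding emeasure_upper_variation[OF assms(2) A]
proof (rule SUP_least, clarify)
  fix B assume B: "B \<in> sets M" "B \<subseteq> A"
  have "ennreal (\<nu> B) \<le> ennreal (norm (\<mu> B))"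
    using assms(3)[of B] by (intro ennreal_leI) auto
  also have "\<dots> \<le> emeasure (variation_measure M \<mu>) B"
    by (rule norm_le_variation_measure[OF assms(1) B(1)])
  also have "\<dots> \<le> emeasure (variation_measure M \<mu>) A"
    by (rule emeasure_mono) (use B A in auto)
  finally show "ennreal (\<nu> B) \<le> emeasure (variation_measure M \<mu>) A" .
qed

lemma le_measure_upper_variation:
  assumes \<nu>: "signed_measure M \<nu>" and fin: "finite_measure (upper_variation M \<nu>)"
    and "A \<in> sets M" "B \<in> sets M" "B \<subseteq> A"
  shows "\<nu> B \<le> measure (upper_variation M \<nu>) A"
proof -
  interpret finite_measure "upper_variation M \<nu>" by fact
  have "ennreal (\<nu> B) \<le> emeasure (upper_variation M \<nu>) A"
    unfolding emeasure_upper_variation[OF \<nu> assms(3)] by (rule SUP_upper) (use assms in auto)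
  then show ?thesis
    using measure_nonneg[of "upper_variation M \<nu>" A]
    by (auto simp: emeasure_eq_measure ennreal_le_iff2)
qed

text \<open>Additivity gives \<open>\<nu> B = \<nu> A - \<nu> (A - B)\<close>, and the last term is
  controlled by the upper variation of \<open>- \<nu>\<close>; then take the supremum over
  \<open>B\<close>. Used for \<open>\<nu>\<close> and for \<open>- \<nu>\<close>, this yields the
  Jordan decomposition without a Hahn set.\<close>

lemma measure_upper_variation_le:
  assumes \<nu>: "signed_measure M \<nu>" and fin: "finite_measure (upper_variation M \<nu>)"
      "finite_measure (upper_variation M (\<lambda>A. - \<nu> A))"
    and A: "A \<in> sets M"
  shows "measure (upper_variation M \<nu>) A \<le> \<nu> A + measure (upper_variation M (\<lambda>A. - \<nu> A)) A"
proof -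
  interpret finite_measure "upper_variation M \<nu>" by fact
  let ?r = "\<nu> A + measure (upper_variation M (\<lambda>A. - \<nu> A)) A"
  have le: "\<nu> B \<le> ?r" if B: "B \<in> sets M" "B \<subseteq> A" for B
  proof -
    have "\<nu> (B \<union> (A - B)) = \<nu> B + \<nu> (A - B)"
      using that A by (intro signed_measure_Un[OF \<nu>]) auto
    moreover have "B \<union> (A - B) = A"
      using that by blast
    moreover have "- \<nu> (A - B) \<le> measure (upper_variation M (\<lambda>A. - \<nu> A)) A"
      using that A by (intro le_measure_upper_variation signed_measure_minus \<nu> fin) auto
    ultimately show ?thesis by simp
  qed
  have "emeasure (upper_variation M \<nu>) A \<le> ennreal ?r"
    unfolding emeasure_upper_variation[OF \<nu> A] by (intro SUP_least ennreal_leI le) auto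
  moreover have "0 \<le> ?r"
    using le[of "{}"] signed_measure_empty[OF \<nu>] by simp
  ultimately show ?thesis
    by (simp add: emeasure_eq_measure ennreal_le_iff)
qed

lemma Jordan_decomposition:
  assumes \<nu>: "signed_measure M \<nu>" and fin: "finite_measure (upper_variation M \<nu>)"
      "finite_measure (upper_variation M (\<lambda>A. - \<nu> A))"
    and A: "A \<in> sets M"
  shows "\<nu> A = measure (upper_variation M \<nu>) A - measure (upper_variation M (\<lambda>A. - \<nu> A)) A"
  using measure_upper_variation_le[OF assms]
    measure_upper_variation_le[OF signed_measure_minus[OF \<nu>], of A] fin A
  by simp

section \<open>Integration against a complex measure\<close>

definition bounded_measurable :: "'a measure \<Rightarrow> ('a \<Rightarrow> complex) set" where
  "bounded_measurable M = {f \<in> borel_measurable M. \<exists>B. \<forall>x\<in>space M. norm (f x) \<le> B}"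

lemma integrable_bounded_measurable:
  assumes "finite_measure N" "sets N = sets M" "f \<in> bounded_measurable M"
  shows "integrable N f"
proof -
  obtain B where "\<forall>x\<in>space N. norm (f x) \<le> B" "f \<in> borel_measurable N"
    using assms sets_eq_imp_space_eq[OF assms(2)] measurable_cong_sets[OF assms(2) refl]
    by (auto simp: bounded_measurable_def)
  then show ?thesis
    by (intro finite_measure.integrable_const_bound[OF assms(1), of f B]) auto
qed

lemma integral_simple_function:
  fixes s :: "'a \<Rightarrow> complex"
  assumes "finite_measure N" "sets N = sets M" "simple_function M s"
  shows "(LINT x|N. s x)
       = (\<Sum>y\<in>s ` space M. y * complex_of_real (measure N (s -` {y} \<inter> space M)))"
proof -
  interpret finite_measure N by fact
  have sp: "space N = space M"
    using assms(2) by (rule sets_eq_imp_space_eq)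
  have meas: "s -` {y} \<inter> space M \<in> sets N" for y
    using assms(2,3) by (auto simp: simple_function_def intro: simple_functionD)
  have "(LINT x|N. s x)
      = (LINT x|N. (\<Sum>y\<in>s ` space M. indicator (s -` {y} \<inter> space M) x *\<^sub>R y))"
    by (intro Bochner_Integration.integral_cong refl simple_function_indicator_representation_banach)
      (use assms sp in auto)
  also have "\<dots> = (\<Sum>y\<in>s ` space M. measure N (s -` {y} \<inter> space M) *\<^sub>R y)"
    using meas by (subst Bochner_Integration.integral_sum) (auto simp: emeasure_eq_measure)
  finally show ?thesis
    by (simp add: scaleR_conv_of_real mult.commute)
qed

text \<open>With infinite total variation the final estimate is trivial. Finiteness makes |\<mu>|
  and the four parts finite measures, so that bounded measurable functions are integrable for all of
  them.\<close>

locale finite_complex_measure =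
  fixes M :: "'a measure" and \<mu> :: "'a set \<Rightarrow> complex"
  assumes complex_measure: "complex_measure M \<mu>"
    and finite_variation: "total_variation M \<mu> < \<infinity>"
begin

sublocale variation: finite_measure "variation_measure M \<mu>"
  by standard
    (use variation_measure_space_le[OF complex_measure] finite_variation in \<open>auto simp: top_unique\<close>)

lemma measure_variation_le: "ennreal (measure (variation_measure M \<mu>) (space M)) \<le> total_variation M \<mu>"
  using variation_measure_space_le[OF complex_measure] by (simp add: variation.emeasure_eq_measure)

lemma finite_measure_upper_variation:
  assumes "signed_measure M \<nu>" "\<And>A. \<bar>\<nu> A\<bar> \<le> norm (\<mu> A)"
  shows "finite_measure (upper_variation M \<nu>)"
proof
  have "emeasure (upper_variation M \<nu>) (space M) \<le> emeasure (variation_measure M \<mu>) (space M)"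
    by (rule upper_variation_le_variation_measure[OF complex_measure assms]) auto
  also have "\<dots> < \<infinity>"
    by (simp add: variation.emeasure_eq_measure)
  finally show "emeasure (upper_variation M \<nu>) (space (upper_variation M \<nu>)) \<noteq> \<infinity>"
    by simp
qed

lemmas signed_parts =
  signed_measure_Re[OF complex_measure] signed_measure_Im[OF complex_measure]
  signed_measure_minus[OF signed_measure_Re[OF complex_measure]]
  signed_measure_minus[OF signed_measure_Im[OF complex_measure]]

lemma finite_parts:
  "finite_measure (upper_variation M (\<lambda>A. Re (\<mu> A)))"
  "finite_measure (upper_variation M (\<lambda>A. - Re (\<mu> A)))"
  "finite_measure (upper_variation M (\<lambda>A. Im (\<mu> A)))"
  "finite_measure (upper_variation M (\<lambda>A. - Im (\<mu> A)))"
  by (intro finite_measure_upper_variation signed_parts; simp add: abs_Re_le_cmod abs_Im_le_cmod)+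

abbreviation cintegral :: "('a \<Rightarrow> complex) \<Rightarrow> complex" where
  "cintegral \<equiv> complex_measure_integral M \<mu>"

lemma cintegral_add:
  assumes "f \<in> bounded_measurable M" "g \<in> bounded_measurable M"
  shows "cintegral (\<lambda>x. f x + g x) = cintegral f + cintegral g"
  using finite_parts[THEN integrable_bounded_measurable, OF sets_upper_variation assms(1)]
    finite_parts[THEN integrable_bounded_measurable, OF sets_upper_variation assms(2)]
  by (simp add: complex_measure_integral_def algebra_simps)

lemma cintegral_cmult: "cintegral (\<lambda>x. c * f x) = c * cintegral f"
  by (simp add: complex_measure_integral_def algebra_simps)

text \<open>Here the four parts recombine to \<open>\<mu>\<close> itself by the Jordan
  decomposition. This lets the next bound involve |\<mu>| with constant 1.\<close>

lemma cintegral_simple: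
  assumes s: "simple_function M s"
  shows "cintegral s = (\<Sum>y\<in>s ` space M. y * \<mu> (s -` {y} \<inter> space M))"
proof -
  have meas: "s -` {y} \<inter> space M \<in> sets M" for y
    using s by (auto intro: simple_functionD)
  note * = integral_simple_function[OF _ sets_upper_variation s]
  have decomp: "\<mu> A = complex_of_real (measure (upper_variation M (\<lambda>A. Re (\<mu> A))) A)
     - complex_of_real (measure (upper_variation M (\<lambda>A. - Re (\<mu> A))) A)
     + \<i> * (complex_of_real (measure (upper_variation M (\<lambda>A. Im (\<mu> A))) A)
          - complex_of_real (measure (upper_variation M (\<lambda>A. - Im (\<mu> A))) A))" if "A \<in> sets M" for A
    using Jordan_decomposition[OF signed_parts(1) finite_parts(1,2) that]
      Jordan_decomposition[OF signed_parts(2) finite_parts(3,4) that]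
    by (simp add: complex_eq_iff)
  show ?thesis
    unfolding complex_measure_integral_def finite_parts[THEN *]
      sum_subtractf[symmetric] sum_distrib_left sum.distrib[symmetric]
    by (intro sum.cong refl) (subst decomp[OF meas], simp add: algebra_simps)
qed

lemma norm_cintegral_simple_le:
  assumes s: "simple_function M s"
  shows "norm (cintegral s) \<le> (LINT x|variation_measure M \<mu>. norm (s x))"
proof -
  have meas: "s -` {y} \<inter> space M \<in> sets M" for y
    using s by (auto intro: simple_functionD)
  have le: "norm (\<mu> A) \<le> measure (variation_measure M \<mu>) A" if "A \<in> sets M" for A
    using norm_le_variation_measure[OF complex_measure that]
    by (simp add: variation.emeasure_eq_measure)
  have "norm (cintegral s) \<le> (\<Sum>y\<in>s ` space M. norm (y * \<mu> (s -` {y} \<inter> space M)))"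
    unfolding cintegral_simple[OF s] by (rule norm_sum)
  also have "\<dots> \<le> (\<Sum>y\<in>s ` space M. measure (variation_measure M \<mu>) (s -` {y} \<inter> space M) * norm y)"
    unfolding norm_mult
    by (intro sum_mono, subst mult.commute) (intro mult_right_mono le[OF meas] norm_ge_zero)
  also have "\<dots> = (LINT x|variation_measure M \<mu>.
      (\<Sum>y\<in>s ` space M. indicator (s -` {y} \<inter> space M) x *\<^sub>R norm y))"
    using meas by (subst Bochner_Integration.integral_sum) (auto simp: variation.emeasure_eq_measure)
  also have "\<dots> = (LINT x|variation_measure M \<mu>. norm (s x))"
  proof (intro Bochner_Integration.integral_cong refl)
    fix x assume "x \<in> space (variation_measure M \<mu>)"
    then have x: "x \<in> space M" by simp
    have "(\<Sum>y\<in>s ` space M. indicator (s -` {y} \<inter> space M) x *\<^sub>R norm y)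
        = (\<Sum>y\<in>s ` space M. if y = s x then norm y else 0)"
      using x by (intro sum.cong) auto
    also have "\<dots> = norm (s x)"
      using x s by (simp add: simple_functionD)
    finally show "(\<Sum>y\<in>s ` space M. indicator (s -` {y} \<inter> space M) x *\<^sub>R norm y) = norm (s x)" .
  qed
  finally show ?thesis .
qed

lemma norm_cintegral_le:
  assumes f: "f \<in> bounded_measurable M"
  shows "norm (cintegral f) \<le> (LINT x|variation_measure M \<mu>. norm (f x))"
proof -
  have meas [measurable]: "f \<in> borel_measurable M"
    using f by (simp add: bounded_measurable_def)
  obtain B where B: "\<And>x. x \<in> space M \<Longrightarrow> norm (f x) \<le> B"
    using f by (auto simp: bounded_measurable_def)
  obtain F where F: "\<forall>i. simple_function M (F i)"
      "\<forall>x\<in>space M. (\<lambda>i. F i x) \<longlonglongrightarrow> f x"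
      "\<forall>i. \<forall>x\<in>space M. dist (F i x) 0 \<le> 2 * dist (f x) 0"
    using borel_measurable_implies_sequence_metric[OF meas, of 0] by (elim exE conjE)
  have [measurable]: "F i \<in> borel_measurable M" for i
    using F(1) by (intro borel_measurable_simple_function) blast
  \<comment> \<open>The factor 2 is the one in the third property of \<open>F\<close>; it only
    affects the dominating constant, not the limit.\<close>
  have FB: "norm (F i x) \<le> 2 * B" if "x \<in> space M" for i x
    using F(3)[rule_format, OF that, of i] B[OF that] by simp
  have lim: "(\<lambda>i. LINT x|N. F i x) \<longlonglongrightarrow> (LINT x|N. f x)"
    if N: "finite_measure N" "sets N = sets M" for N
  proof -
    have "space N = space M"
      using N(2) by (rule sets_eq_imp_space_eq)
    moreover have "integrable N (\<lambda>_. 2 * B)"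
      using N(1) by (simp add: finite_measure.integrable_const)
    ultimately show ?thesis
      using N(2) F FB by (intro integral_dominated_convergence[where w = "\<lambda>_. 2 * B"])
        (auto simp: measurable_cong_sets[OF N(2) refl])
  qed
  have "(\<lambda>i. norm (cintegral (F i))) \<longlonglongrightarrow> norm (cintegral f)"
    unfolding complex_measure_integral_def
    by (intro tendsto_intros lim finite_parts sets_upper_variation)
  moreover have "(\<lambda>i. LINT x|variation_measure M \<mu>. norm (F i x))
      \<longlonglongrightarrow> (LINT x|variation_measure M \<mu>. norm (f x))"
    using F FB by (intro integral_dominated_convergence[where w = "\<lambda>_. 2 * B"])
      (auto intro!: tendsto_norm)
  ultimately show ?thesis
    using norm_cintegral_simple_le[OF F(1)[rule_format]] by (intro LIMSEQ_le) auto
qed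

end

section \<open>Dominated functionals on the circle\<close>

abbreviation cont_circle :: "(complex \<Rightarrow> 'b::topological_space) \<Rightarrow> bool" where
  "cont_circle \<equiv> continuous_on (sphere 0 1)"

lemma cont_circle_bounded:
  fixes f :: "complex \<Rightarrow> 'b::real_normed_vector"
  assumes f: "cont_circle f"
  obtains B where "0 \<le> B" "\<And>x. norm x = 1 \<Longrightarrow> norm (f x) \<le> B"
proof -
  have "bounded (f ` sphere 0 1)"
    by (intro compact_imp_bounded compact_continuous_image[OF f]) simp
  then obtain B where "\<forall>x\<in>sphere 0 1. norm (f x) \<le> B"
    unfolding bounded_iff by blast
  then show ?thesis
    using that[of "max 0 B"] by (simp add: le_max_iff_disj)
qed

text \<open>What the operator argument uses of a complex measure: a linear functional on continuous
  functions on the circle, with \<open>m\<close> in the role of the variation. Functions are total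
  on \<open>complex\<close>; domination makes \<open>L\<close> depend only on their values on the
  circle.\<close>

locale dominated_functional =
  fixes L :: "(complex \<Rightarrow> complex) \<Rightarrow> complex" and m :: "complex measure"
  assumes finite_m: "finite_measure m"
    and sets_m: "sets m = sets circle_borel"
    and L_add: "cont_circle f \<Longrightarrow> cont_circle g \<Longrightarrow> L (\<lambda>x. f x + g x) = L f + L g"
    and L_cmult: "L (\<lambda>x. c * f x) = c * L f"
    and L_le: "cont_circle f \<Longrightarrow> norm (L f) \<le> (LINT x|m. norm (f x))"
begin

lemma space_m: "space m = sphere 0 1"
  using sets_eq_imp_space_eq[OF sets_m] by (simp add: circle_borel_def space_restrict_space)

lemma integrable_cont:
  fixes f :: "complex \<Rightarrow> 'b :: {banach, second_countable_topology}"
  assumes f: "cont_circle f"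
  shows "integrable m f"
proof -
  have "f \<in> borel_measurable circle_borel"
    unfolding circle_borel_def by (rule borel_measurable_continuous_on_restrict[OF f])
  then have "f \<in> borel_measurable m"
    using measurable_cong_sets[OF sets_m refl] by blast
  moreover obtain B where "\<And>x. norm x = 1 \<Longrightarrow> norm (f x) \<le> B"
    using cont_circle_bounded[OF f] by blast
  ultimately show ?thesis
    by (intro finite_measure.integrable_const_bound[OF finite_m, of f B] AE_I2) (simp_all add: space_m)
qed

lemma LINT_cong: "(\<And>x. norm x = 1 \<Longrightarrow> f x = g x) \<Longrightarrow> (LINT x|m. f x) = (LINT x|m. g x)"
  by (intro Bochner_Integration.integral_cong) (auto simp: space_m)

lemma L_zero: "L (\<lambda>x. 0) = 0"
  using L_cmult[of 0 "\<lambda>_. 0"] by simp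

lemma L_diff: "cont_circle f \<Longrightarrow> cont_circle g \<Longrightarrow> L (\<lambda>x. f x - g x) = L f - L g"
  using L_add[of f "\<lambda>x. (-1) * g x"] L_cmult[of "-1" g]
  by (simp add: continuous_on_minus)

lemma L_sum:
  assumes "\<And>i. i \<in> I \<Longrightarrow> cont_circle (f i)"
  shows "L (\<lambda>x. \<Sum>i\<in>I. c i * f i x) = (\<Sum>i\<in>I. c i * L (f i))"
  using assms
proof (induction I rule: infinite_finite_induct)
  case (insert i I)
  then show ?case
    by (simp add: L_add L_cmult continuous_intros)
qed (simp_all add: L_zero)

lemma L_cong:
  assumes "cont_circle f" "cont_circle g" "\<And>x. norm x = 1 \<Longrightarrow> f x = g x"
  shows "L f = L g"
proof -
  have "norm (L (\<lambda>x. f x - g x)) \<le> (LINT x|m. norm (f x - g x))"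
    by (intro L_le continuous_intros assms)
  also have "\<dots> = (LINT x|m. 0)"
    using assms(3) by (intro LINT_cong) auto
  finally show ?thesis
    using assms by (simp add: L_diff)
qed

section \<open>The L2 seminorm of \<open>m\<close>: Cauchy-Schwarz, Bessel, Gram-Schmidt\<close>

abbreviation mass :: real where
  "mass \<equiv> measure m (space m)"

definition sqnorm :: "(complex \<Rightarrow> complex) \<Rightarrow> real" where
  "sqnorm f = (LINT x|m. (norm (f x))\<^sup>2)"

definition ip :: "(complex \<Rightarrow> complex) \<Rightarrow> (complex \<Rightarrow> complex) \<Rightarrow> complex" where
  "ip f g = (LINT x|m. f x * cnj (g x))"

lemma sqnorm_nonneg: "0 \<le> sqnorm f"
  by (simp add: sqnorm_def)

lemma ip_same: "ip f f = complex_of_real (sqnorm f)"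
  by (simp add: ip_def sqnorm_def complex_norm_square[symmetric] flip: of_real_power)

lemma cnj_ip: "cnj (ip f g) = ip g f"
proof -
  have "cnj (ip f g) = (LINT x|m. cnj (f x * cnj (g x)))"
    unfolding ip_def by (rule Bochner_Integration.integral_cnj[symmetric])
  then show ?thesis
    by (simp add: ip_def mult.commute)
qed

lemma ip_cong: "(\<And>x. norm x = 1 \<Longrightarrow> f x = f' x) \<Longrightarrow> ip f g = ip f' g"
  unfolding ip_def by (intro LINT_cong) simp

lemma ip_add:
  "cont_circle f \<Longrightarrow> cont_circle g \<Longrightarrow> cont_circle h \<Longrightarrow> ip (\<lambda>x. f x + g x) h = ip f h + ip g h"
  by (simp add: ip_def ring_distribs integrable_cont continuous_intros)

lemma ip_diff:
  "cont_circle f \<Longrightarrow> cont_circle g \<Longrightarrow> cont_circle h \<Longrightarrow> ip (\<lambda>x. f x - g x) h = ip f h - ip g h"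
  by (simp add: ip_def ring_distribs integrable_cont continuous_intros)

lemma ip_cmult: "ip (\<lambda>x. c * f x) h = c * ip f h"
  by (simp add: ip_def mult.assoc)

lemma ip_zero: "ip (\<lambda>x. 0) h = 0"
  by (simp add: ip_def)

lemma ip_sum:
  assumes "\<And>i. i \<in> I \<Longrightarrow> cont_circle (f i)" "cont_circle h"
  shows "ip (\<lambda>x. \<Sum>i\<in>I. c i * f i x) h = (\<Sum>i\<in>I. c i * ip (f i) h)"
  using assms
proof (induction I rule: infinite_finite_induct)
  case (insert i I)
  then show ?case
    by (simp add: ip_add ip_cmult continuous_intros)
qed (simp_all add: ip_zero)

lemma ip_cmult_right: "ip f (\<lambda>x. c * g x) = cnj c * ip f g"
  using ip_cmult[of c g f] by (metis cnj_ip complex_cnj_mult)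

lemma ip_diff_right:
  "cont_circle f \<Longrightarrow> cont_circle g \<Longrightarrow> cont_circle h \<Longrightarrow> ip f (\<lambda>x. g x - h x) = ip f g - ip f h"
  using ip_diff[of g h f] by (metis cnj_ip complex_cnj_diff)

text \<open>Cauchy-Schwarz against the constant 1, from the nonnegative integral of
  \<open>(mass * norm (f x) - ?a)\<^sup>2\<close>, which equals
  \<open>mass * (mass * sqnorm f - ?a\<^sup>2)\<close>. Cancelling \<open>mass\<close> requires the
  separate case \<open>mass = 0\<close>.\<close>

lemma square_LINT_norm_le:
  assumes f: "cont_circle f"
  shows "(LINT x|m. norm (f x))\<^sup>2 \<le> mass * sqnorm f"
proof (cases "mass = 0")
  case True
  interpret finite_measure m by (fact finite_m)
  have "emeasure m (space m) = 0"
    using True by (simp add: emeasure_eq_measure)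
  then have "AE x in m. norm (f x) = 0"
    by (intro AE_I[where N = "space m"]) auto
  then have "(LINT x|m. norm (f x)) = 0"
    by (rule integral_eq_zero_AE)
  with True show ?thesis by simp
next
  case False
  interpret finite_measure m by (fact finite_m)
  let ?a = "LINT x|m. norm (f x)"
  have [simp]: "integrable m (\<lambda>x. norm (f x))" "integrable m (\<lambda>x. (norm (f x))\<^sup>2)"
    by (intro integrable_cont continuous_intros f)+
  have "0 \<le> (LINT x|m. (mass * norm (f x) - ?a)\<^sup>2)"
    by simp
  also have "(\<lambda>x. (mass * norm (f x) - ?a)\<^sup>2)
      = (\<lambda>x. mass\<^sup>2 * (norm (f x))\<^sup>2 - (2 * mass * ?a) * norm (f x) + ?a\<^sup>2)"
    by (simp add: power2_eq_square algebra_simps)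
  also have "(LINT x|m. mass\<^sup>2 * (norm (f x))\<^sup>2 - (2 * mass * ?a) * norm (f x) + ?a\<^sup>2)
      = mass\<^sup>2 * sqnorm f - (2 * mass * ?a) * ?a + mass * ?a\<^sup>2"
    by (simp add: sqnorm_def)
  also have "\<dots> = mass * (mass * sqnorm f - ?a\<^sup>2)"
    by (simp add: power2_eq_square algebra_simps)
  finally show ?thesis
    using False measure_nonneg[of m "space m"] by (simp add: zero_le_mult_iff)
qed

lemma square_le_of_dominated:
  assumes "cont_circle f" "norm a \<le> (LINT x|m. norm (f x))"
  shows "(norm a)\<^sup>2 \<le> mass * sqnorm f"
  by (rule order_trans[OF power_mono[OF assms(2)] square_LINT_norm_le[OF assms(1)]]) simp

text \<open>A continuous \<open>F\<close> is bounded on the circle, so the product is again a null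
  function, and Cauchy-Schwarz makes \<open>L\<close> vanish on it. The independence proof exploits
  the freedom in \<open>F\<close>.\<close>

lemma L_null:
  assumes f: "cont_circle f" and F: "cont_circle F" and null: "sqnorm f = 0"
  shows "L (\<lambda>x. F x * f x) = 0"
proof -
  obtain B where B: "\<And>x. norm x = 1 \<Longrightarrow> norm (F x) \<le> B"
    using cont_circle_bounded[OF F] by blast
  have "sqnorm (\<lambda>x. F x * f x) \<le> (LINT x|m. B\<^sup>2 * (norm (f x))\<^sup>2)"
    unfolding sqnorm_def
  proof (intro integral_mono)
    show "(norm (F x * f x))\<^sup>2 \<le> B\<^sup>2 * (norm (f x))\<^sup>2" if "x \<in> space m" for x
      using B that by (auto simp: space_m norm_mult power_mult_distrib intro!: mult_right_mono power_mono)
  qed (intro integrable_cont continuous_intros f F)+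
  also have "\<dots> = 0"
    using null by (simp add: sqnorm_def)
  finally have "mass * sqnorm (\<lambda>x. F x * f x) \<le> 0"
    by (simp add: mult_nonneg_nonpos)
  moreover have "(norm (L (\<lambda>x. F x * f x)))\<^sup>2 \<le> mass * sqnorm (\<lambda>x. F x * f x)"
    by (intro square_le_of_dominated L_le continuous_intros f F)
  ultimately have "(norm (L (\<lambda>x. F x * f x)))\<^sup>2 \<le> 0"
    by linarith
  then show ?thesis by simp
qed

text \<open>On the combination \<open>f\<close> of the \<open>u j\<close> with coefficients
  \<open>a j\<close>, both \<open>\<Lambda> f\<close> and \<open>sqnorm f\<close> equal the sum
  \<open>S\<close> in question; domination then gives \<open>S * S \<le> mass * S\<close>. The
  system is orthogonal but not normalised, whence the denominators. Serves both for \<open>L\<close>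
  and for integration against \<open>m\<close>.\<close>

lemma Bessel_dominated:
  fixes u :: "nat \<Rightarrow> complex \<Rightarrow> complex"
  assumes u: "\<And>j. j < n \<Longrightarrow> cont_circle (u j)"
    and nz: "\<And>j. j < n \<Longrightarrow> sqnorm (u j) \<noteq> 0"
    and orth: "\<And>i j. i < n \<Longrightarrow> j < n \<Longrightarrow> i \<noteq> j \<Longrightarrow> ip (u i) (u j) = 0"
    and \<Lambda>_sum: "\<And>c. \<Lambda> (\<lambda>x. \<Sum>j<n. c j * u j x) = (\<Sum>j<n. c j * \<Lambda> (u j))"
    and \<Lambda>_le: "\<And>f. cont_circle f \<Longrightarrow> norm (\<Lambda> f) \<le> (LINT x|m. norm (f x))"
  shows "(\<Sum>j<n. (norm (\<Lambda> (u j)))\<^sup>2 / sqnorm (u j)) \<le> mass"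
proof -
  define a where "a j = cnj (\<Lambda> (u j)) / complex_of_real (sqnorm (u j))" for j
  define f where "f = (\<lambda>x. \<Sum>j<n. a j * u j x)"
  define S where "S = (\<Sum>j<n. (norm (\<Lambda> (u j)))\<^sup>2 / sqnorm (u j))"
  have f: "cont_circle f"
    unfolding f_def by (intro continuous_intros u) auto
  have sq: "cnj w * w = complex_of_real ((norm w)\<^sup>2)" for w
    by (metis complex_norm_square mult.commute)
  have "\<Lambda> f = (\<Sum>j<n. complex_of_real ((norm (\<Lambda> (u j)))\<^sup>2 / sqnorm (u j)))"
    unfolding f_def \<Lambda>_sum by (intro sum.cong refl) (simp add: a_def sq)
  then have \<Lambda>f: "\<Lambda> f = complex_of_real S"
    by (simp add: S_def)
  have ip_uf: "ip (u j) f = cnj (a j) * complex_of_real (sqnorm (u j))" if j: "j < n" for j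
  proof -
    have "ip f (u j) = (\<Sum>i<n. a i * ip (u i) (u j))"
      unfolding f_def by (rule ip_sum) (use u j in auto)
    also have "\<dots> = (\<Sum>i<n. if i = j then a j * ip (u j) (u j) else 0)"
      by (intro sum.cong refl) (use orth j in auto)
    also have "\<dots> = a j * complex_of_real (sqnorm (u j))"
      using j by (simp add: ip_same)
    finally show ?thesis
      by (metis cnj_ip complex_cnj_mult complex_cnj_complex_of_real)
  qed
  have "complex_of_real (sqnorm f) = ip f f"
    by (simp add: ip_same)
  also have "\<dots> = (\<Sum>j<n. a j * ip (u j) f)"
    by (subst f_def, rule ip_sum) (use u f in auto)
  also have "\<dots> = (\<Sum>j<n. complex_of_real ((norm (\<Lambda> (u j)))\<^sup>2 / sqnorm (u j)))"
    using nz by (intro sum.cong refl) (simp add: ip_uf a_def sq)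
  finally have sqf: "sqnorm f = S"
    unfolding S_def by (simp only: of_real_sum[symmetric] of_real_eq_iff)
  have S0: "0 \<le> S"
    unfolding S_def by (intro sum_nonneg) (auto simp: sqnorm_nonneg)
  have "(norm (\<Lambda> f))\<^sup>2 \<le> mass * sqnorm f"
    by (intro square_le_of_dominated \<Lambda>_le f)
  then have "S * S \<le> mass * S"
    using S0 by (simp add: \<Lambda>f sqf power2_eq_square)
  then have "S \<le> mass"
    using S0 measure_nonneg[of m "space m"] by (cases "S = 0") auto
  then show ?thesis
    by (simp add: S_def)
qed

text \<open>Gram-Schmidt in a form suited to induction: orthogonality is asked against the original
  \<open>v k\<close>, and \<open>f\<close> keeps coefficient 1. The condition on
  \<open>sqnorm\<close> is independence modulo null functions; it makes the divisor
  \<open>ip u u\<close> nonzero.\<close>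

lemma ex_orthogonal:
  fixes v :: "nat \<Rightarrow> complex \<Rightarrow> complex"
  assumes "\<And>i. cont_circle (v i)"
    and "\<And>k c. k < j \<Longrightarrow> sqnorm (\<lambda>x. v k x + (\<Sum>i<k. c i * v i x)) \<noteq> 0"
    and "cont_circle f"
  shows "\<exists>c. \<forall>k<j. ip (v k) (\<lambda>x. f x + (\<Sum>i<j. c i * v i x)) = 0"
  using assms(2,3)
proof (induction j arbitrary: f)
  case (Suc j)
  note v [continuous_intros] = assms(1)
  note f [continuous_intros] = \<open>cont_circle f\<close>
  obtain a where a: "\<And>k. k < j \<Longrightarrow> ip (v k) (\<lambda>x. v j x + (\<Sum>i<j. a i * v i x)) = 0"
    using Suc.IH[of "v j"] Suc.prems v by (meson less_SucI)
  obtain b where b: "\<And>k. k < j \<Longrightarrow> ip (v k) (\<lambda>x. f x + (\<Sum>i<j. b i * v i x)) = 0"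
    using Suc.IH[of f] Suc.prems by (meson less_SucI)
  define u where "u = (\<lambda>x. v j x + (\<Sum>i<j. a i * v i x))"
  define f1 where "f1 = (\<lambda>x. f x + (\<Sum>i<j. b i * v i x))"
  \<comment> \<open>Chosen so that \<open>ip u (f1 - t * u) = 0\<close>; the conjugate is due to
    \<open>ip\<close> being antilinear in its second argument.\<close>
  define t where "t = cnj (ip u f1 / ip u u)"
  define f2 where "f2 = (\<lambda>x. f1 x - t * u x)"
  have u [continuous_intros]: "cont_circle u"
    unfolding u_def by (intro continuous_intros)
  have f1 [continuous_intros]: "cont_circle f1"
    unfolding f1_def by (intro continuous_intros)
  have f2 [continuous_intros]: "cont_circle f2"
    unfolding f2_def by (intro continuous_intros)
  have ip_f2: "ip g f2 = ip g f1 - ip u f1 / ip u u * ip g u" if "cont_circle g" for g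
    unfolding f2_def using that
    by (simp add: ip_diff_right ip_cmult_right continuous_intros) (simp add: t_def)
  have uu: "ip u u \<noteq> 0"
    using Suc.prems(1)[of j a] by (simp add: ip_same u_def)
  have lt: "ip (v k) f2 = 0" if "k < j" for k
    using a[OF that] b[OF that] by (simp add: ip_f2 v flip: u_def f1_def)
  have "ip u f2 = 0"
    using uu by (simp add: ip_f2 u)
  \<comment> \<open>\<open>u\<close> and \<open>v j\<close> differ by a combination of the
    \<open>v i\<close> with \<open>i < j\<close>, to which \<open>f2\<close> is already
    orthogonal.\<close>
  moreover have "ip u f2 = ip (v j) f2 + (\<Sum>i<j. a i * ip (v i) f2)"
    unfolding u_def by (subst ip_add) (auto intro!: continuous_intros simp: ip_sum v f2)
  ultimately have "ip (v j) f2 = 0"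
    using lt by simp
  then have *: "ip (v k) f2 = 0" if "k < Suc j" for k
    using lt that by (cases "k = j") auto
  define c where "c i = (if i = j then - t else b i - t * a i)" for i
  have "f2 = (\<lambda>x. f x + (\<Sum>i<Suc j. c i * v i x))"
    by (rule ext) (simp add: f2_def f1_def u_def c_def algebra_simps sum_subtractf sum_distrib_left)
  with * show ?case by auto
qed simp

end

section \<open>The Cauchy kernel at the zeros\<close>

text \<open>Only \<open>w = a\<close> needs an argument: there both values are limits from nearby
  points. This is how repeated zeros are reached, where \<open>w - a\<close> cannot be divided
  out.\<close>

lemma eq_on_ball_of_mult_eq:
  fixes F G :: "complex \<Rightarrow> complex"
  assumes "continuous_on (ball 0 1) F" "continuous_on (ball 0 1) G" "a \<in> ball 0 1"
    and eq: "\<And>w. w \<in> ball 0 1 \<Longrightarrow> (w - a) * F w = (w - a) * G w"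
    and w: "w \<in> ball 0 1"
  shows "F w = G w"
proof (cases "w = a")
  case True
  have lim: "(H \<longlongrightarrow> H a) (at a)" if "continuous_on (ball 0 1) H" for H :: "complex \<Rightarrow> complex"
    using that assms(3) by (metis at_within_open continuous_on_def open_ball)
  have "eventually (\<lambda>x. x \<in> ball 0 1 \<and> x \<noteq> a) (at a)"
    using assms(3) eventually_at_in_open[of "ball 0 1" a] by simp
  then have "eventually (\<lambda>x. F x = G x) (at a)"
    by eventually_elim (use eq in auto)
  then have "(F \<longlongrightarrow> G a) (at a)"
    using lim[OF assms(2)] by (simp add: tendsto_cong)
  with lim[OF assms(1)] True show ?thesis
    by (metis tendsto_unique trivial_limit_at)
qed (use eq[OF w] in auto)

definition kernel :: "complex \<Rightarrow> complex \<Rightarrow> complex" where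
  "kernel w \<zeta> = 1 / (1 - w * cnj \<zeta>)"

lemma kernel_denom_ge:
  assumes "norm \<zeta> = 1"
  shows "1 - norm w \<le> norm (1 - w * cnj \<zeta>)"
  using norm_triangle_ineq2[of 1 "w * cnj \<zeta>"] assms by (simp add: norm_mult)

lemma kernel_denom_nz:
  assumes "norm w < 1" "norm \<zeta> = 1"
  shows "1 - w * cnj \<zeta> \<noteq> 0"
  using kernel_denom_ge[OF assms(2), of w] assms(1) by auto

lemma cont_circle_kernel [continuous_intros]:
  "norm w < 1 \<Longrightarrow> cont_circle (kernel w)"
  unfolding kernel_def[abs_def]
  by (intro continuous_intros) (auto dest: kernel_denom_nz)

lemma norm_kernel_le:
  assumes "norm w < 1" "norm \<zeta> = 1"
  shows "norm (kernel w \<zeta>) \<le> 1 / (1 - norm w)"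
  using kernel_denom_ge[OF assms(2), of w] assms(1)
  by (simp add: kernel_def norm_divide frac_le)

text \<open>The resolvent identity: under \<open>L\<close> it turns a product of two kernels into a
  divided difference of \<open>w * L (kernel w)\<close>, that is, of \<open>h w - 1\<close>.\<close>

lemma kernel_resolvent:
  assumes "norm a < 1" "norm b < 1" "norm \<zeta> = 1"
  shows "(a - b) * (kernel a \<zeta> * kernel b \<zeta>) = a * kernel a \<zeta> - b * kernel b \<zeta>"
  using kernel_denom_nz[OF assms(1,3)] kernel_denom_nz[OF assms(2,3)]
  by (simp add: kernel_def divide_simps) algebra

lemma kernel_diff:
  assumes "norm a < 1" "norm b < 1" "norm \<zeta> = 1"
  shows "kernel a \<zeta> - kernel b \<zeta> = (a - b) * (cnj \<zeta> * kernel a \<zeta> * kernel b \<zeta>)"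
  using kernel_denom_nz[OF assms(1,3)] kernel_denom_nz[OF assms(2,3)]
  by (simp add: kernel_def divide_simps) algebra

lemma cnj_times_kernel:
  assumes "norm a < 1" "norm \<zeta> = 1" "a \<noteq> 0"
  shows "cnj \<zeta> * kernel a \<zeta> = (kernel a \<zeta> - 1) / a"
  using kernel_denom_nz[OF assms(1,2)] assms(3)
  by (simp add: kernel_def divide_simps)

context dominated_functional
begin

lemma norm_L_le:
  assumes "cont_circle f" "\<And>x. norm x = 1 \<Longrightarrow> norm (f x) \<le> B"
  shows "norm (L f) \<le> mass * B"
proof -
  interpret finite_measure m by (fact finite_m)
  have "norm (L f) \<le> (LINT x|m. norm (f x))"
    by (rule L_le[OF assms(1)])
  also have "\<dots> \<le> (LINT x|m. B)"
    by (intro integral_mono integrable_cont continuous_intros assms(1))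
      (auto simp: space_m intro: assms(2))
  finally show ?thesis by simp
qed

text \<open>The difference of two kernels is \<open>w - a\<close> times a function bounded uniformly
  for \<open>w\<close> near \<open>a\<close>, and \<open>L\<close> is bounded in the supremum
  norm.\<close>

lemma continuous_L_kernel:
  assumes F: "cont_circle F"
  shows "continuous_on (ball 0 1) (\<lambda>w. L (\<lambda>\<zeta>. F \<zeta> * kernel w \<zeta>))"
  unfolding continuous_on_eq_continuous_at[OF open_ball] isCont_def
proof
  fix a :: complex assume "a \<in> ball 0 1"
  then have a: "norm a < 1" by simp
  obtain B where B: "0 \<le> B" "\<And>x. norm x = 1 \<Longrightarrow> norm (F x) \<le> B"
    using cont_circle_bounded[OF F] by blast
  let ?G = "\<lambda>w. L (\<lambda>\<zeta>. F \<zeta> * kernel w \<zeta>)"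
  let ?K = "\<lambda>w. norm (w - a) * (mass * (B * (1 / (1 - norm w) * (1 / (1 - norm a)))))"
  have bound: "norm (?G w - ?G a) \<le> ?K w" if w: "norm w < 1" for w
  proof -
    let ?f = "\<lambda>\<zeta>. F \<zeta> * (cnj \<zeta> * kernel w \<zeta> * kernel a \<zeta>)"
    have f: "cont_circle ?f"
      by (intro continuous_intros F w a)
    have "?G w - ?G a = L (\<lambda>\<zeta>. F \<zeta> * kernel w \<zeta> - F \<zeta> * kernel a \<zeta>)"
      by (intro L_diff[symmetric] continuous_intros F w a)
    also have "\<dots> = L (\<lambda>\<zeta>. (w - a) * ?f \<zeta>)"
    proof (intro L_cong continuous_intros F w a)
      show "F x * kernel w x - F x * kernel a x = (w - a) * ?f x" if "norm x = 1" for x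
        unfolding right_diff_distrib[symmetric] kernel_diff[OF w a that] by (simp only: mult_ac)
    qed
    also have "norm \<dots> = norm (w - a) * norm (L ?f)"
      by (simp add: L_cmult norm_mult)
    also have "\<dots> \<le> ?K w"
    proof (intro mult_left_mono norm_L_le f)
      fix x :: complex assume x: "norm x = 1"
      show "norm (?f x) \<le> B * (1 / (1 - norm w) * (1 / (1 - norm a)))"
        using B(1) B(2)[OF x] norm_kernel_le[OF w x] norm_kernel_le[OF a x] x
        unfolding norm_mult complex_mod_cnj
        by (simp only: mult_1_left) (intro mult_mono mult_nonneg_nonneg; use w a in simp)
    qed simp
    finally show ?thesis .
  qed
  show "?G \<midarrow>a\<rightarrow> ?G a"
  proof (rule Lim_null[THEN iffD2], rule Lim_null_comparison)
    have "eventually (\<lambda>w. w \<in> ball 0 1) (at a)"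
      using a by (intro eventually_at_in_open') auto
    then show "eventually (\<lambda>w. norm (?G w - ?G a) \<le> ?K w) (at a)"
      by eventually_elim (use bound in auto)
    have "(?K \<longlongrightarrow> norm (a - a) * (mass * (B * (1 / (1 - norm a) * (1 / (1 - norm a)))))) (at a)"
      using a by (intro tendsto_intros) auto
    then show "(?K \<longlongrightarrow> 0) (at a)" by simp
  qed
qed

end

text \<open>\<open>z\<close> lists finitely many zeros of \<open>h\<close> with repetitions, and
  \<open>g\<close> is the remaining factor, which may vanish too. \<open>z_ball\<close> covers
  indices beyond \<open>n\<close> as well, so that every \<open>kernel (z i)\<close> is continuous
  without side conditions.\<close>

locale perturbed_zeros = dominated_functional +
  fixes h g :: "complex \<Rightarrow> complex" and z :: "nat \<Rightarrow> complex" and n :: nat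
  assumes h_eq: "\<And>w. norm w < 1 \<Longrightarrow> h w = 1 + w * L (kernel w)"
    and z_ball: "\<And>i. norm (z i) < 1"
    and h_factor: "\<And>w. norm w < 1 \<Longrightarrow> h w = (\<Prod>i<n. w - z i) * g w"
    and g_cont: "continuous_on (ball 0 1) g"
begin

lemma h_z: "i < n \<Longrightarrow> h (z i) = 0"
  using h_factor[OF z_ball, of i] by (auto intro: prod_zero)

lemma z_nz: "i < n \<Longrightarrow> z i \<noteq> 0"
  using h_z[of i] h_eq[OF z_ball, of i] by auto

text \<open>The \<open>p 0 i\<close> with \<open>i < n\<close> are the generalised eigenvectors:
  unlike the single kernels, these products stay independent when zeros are repeated. Products
  starting at \<open>k > 0\<close> arise when the first \<open>k\<close> kernels are
  cancelled.\<close>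

definition p :: "nat \<Rightarrow> nat \<Rightarrow> complex \<Rightarrow> complex" where
  "p k i \<zeta> = (\<Prod>l\<in>{k..i}. kernel (z l) \<zeta>)"

lemma cont_circle_p [continuous_intros]: "cont_circle (p k i)"
  unfolding p_def[abs_def] by (intro continuous_intros z_ball)

lemma p_Suc: "k \<le> Suc i \<Longrightarrow> p k (Suc i) \<zeta> = p k i \<zeta> * kernel (z (Suc i)) \<zeta>"
  by (simp add: p_def mult.commute)

lemma p_same: "p k k = kernel (z k)"
  by (rule ext) (simp add: p_def)

text \<open>
  Up to a factor, the left-hand side is a divided difference of \<open>h\<close> at zeros of \<open>h\<close>; zeros
  repeated in the sequence are reached by continuity in \<open>w\<close>.
\<close>

lemma L_p_kernel:
  assumes "k \<le> i" "i < n" "w \<in> ball 0 1"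
  shows "L (\<lambda>\<zeta>. p k i \<zeta> * kernel w \<zeta>) = w ^ (i - k) * (\<Prod>l\<in>{..<n} - {k..i}. w - z l) * g w"
  using assms
proof (induction i arbitrary: w rule: dec_induct)
  case base
  let ?R = "\<lambda>w. (\<Prod>l\<in>{..<n} - {k}. w - z l) * g w"
  have "L (\<lambda>\<zeta>. p k k \<zeta> * kernel w \<zeta>) = ?R w"
  proof (rule eq_on_ball_of_mult_eq[of "\<lambda>w. L (\<lambda>\<zeta>. p k k \<zeta> * kernel w \<zeta>)" ?R "z k"])
    show "continuous_on (ball 0 1) (\<lambda>w. L (\<lambda>\<zeta>. p k k \<zeta> * kernel w \<zeta>))"
      by (intro continuous_L_kernel continuous_intros)
    show "continuous_on (ball 0 1) ?R"
      by (intro continuous_intros g_cont)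
    fix w :: complex assume "w \<in> ball 0 1"
    then have w: "norm w < 1" by simp
    have "(w - z k) * L (\<lambda>\<zeta>. p k k \<zeta> * kernel w \<zeta>) = L (\<lambda>\<zeta>. (w - z k) * (kernel (z k) \<zeta> * kernel w \<zeta>))"
      by (simp add: L_cmult p_same)
    also have "\<dots> = L (\<lambda>\<zeta>. w * kernel w \<zeta> - z k * kernel (z k) \<zeta>)"
    proof (intro L_cong continuous_intros z_ball w)
      show "(w - z k) * (kernel (z k) x * kernel w x) = w * kernel w x - z k * kernel (z k) x"
        if "norm x = 1" for x
        using kernel_resolvent[OF w z_ball that, of k] by (simp add: mult.commute)
    qed
    also have "\<dots> = w * L (kernel w) - z k * L (kernel (z k))"
      by (subst L_diff) (auto intro!: continuous_intros z_ball w simp: L_cmult)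
    also have "\<dots> = h w - h (z k)"
      using h_eq[OF w] h_eq[OF z_ball] by simp
    also have "\<dots> = (w - z k) * ?R w"
      using h_factor[OF w] h_z[OF base.prems(1)] base.prems(1)
      by (simp add: prod.remove[of "{..<n}" k])
    finally show "(w - z k) * L (\<lambda>\<zeta>. p k k \<zeta> * kernel w \<zeta>) = (w - z k) * ?R w" .
  qed (use base.prems z_ball in auto)
  then show ?case by simp
next
  case (step i)
  define R where "R i w = w ^ (i - k) * (\<Prod>l\<in>{..<n} - {k..i}. w - z l) * g w" for i w
  have "L (\<lambda>\<zeta>. p k (Suc i) \<zeta> * kernel w \<zeta>) = R (Suc i) w"
  proof (rule eq_on_ball_of_mult_eq[of "\<lambda>w. L (\<lambda>\<zeta>. p k (Suc i) \<zeta> * kernel w \<zeta>)" "R (Suc i)" "z (Suc i)"])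
    show "continuous_on (ball 0 1) (\<lambda>w. L (\<lambda>\<zeta>. p k (Suc i) \<zeta> * kernel w \<zeta>))"
      by (intro continuous_L_kernel continuous_intros)
    show "continuous_on (ball 0 1) (R (Suc i))"
      unfolding R_def by (intro continuous_intros g_cont)
    fix w :: complex assume w': "w \<in> ball 0 1"
    then have w: "norm w < 1" by simp
    let ?z = "z (Suc i)"
    have IH: "L (\<lambda>\<zeta>. p k i \<zeta> * kernel w \<zeta>) = R i w" if "w \<in> ball 0 1" for w
      using step.IH[of w] step.prems that by (simp add: R_def)
    have "(w - ?z) * L (\<lambda>\<zeta>. p k (Suc i) \<zeta> * kernel w \<zeta>)
        = L (\<lambda>\<zeta>. (w - ?z) * (p k i \<zeta> * kernel ?z \<zeta> * kernel w \<zeta>))"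
      using step.hyps by (simp add: L_cmult p_Suc)
    also have "\<dots> = L (\<lambda>\<zeta>. w * (p k i \<zeta> * kernel w \<zeta>) - ?z * (p k i \<zeta> * kernel ?z \<zeta>))"
    proof (intro L_cong continuous_intros z_ball w)
      fix x :: complex assume "norm x = 1"
      from kernel_resolvent[OF w z_ball this, of "Suc i"]
      have "p k i x * ((w - ?z) * (kernel w x * kernel ?z x))
          = p k i x * (w * kernel w x - ?z * kernel ?z x)" by simp
      then show "(w - ?z) * (p k i x * kernel ?z x * kernel w x)
          = w * (p k i x * kernel w x) - ?z * (p k i x * kernel ?z x)"
        by (simp add: algebra_simps)
    qed
    also have "\<dots> = w * R i w - ?z * R i ?z"
      by (subst L_diff) (auto intro!: continuous_intros z_ball w simp: L_cmult IH w w' z_ball)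
    \<comment> \<open>The index \<open>Suc i\<close> still belongs to the product in
      \<open>R i\<close>, so only \<open>w * R i w\<close> survives; this is the source of the power
      of \<open>w\<close>.\<close>
    also have "R i ?z = 0"
      using step.prems step.hyps by (auto simp: R_def intro!: prod_zero bexI[of _ "Suc i"])
    also have "w * R i w - ?z * 0 = (w - ?z) * R (Suc i) w"
    proof -
      have "{..<n} - {k..i} = insert (Suc i) ({..<n} - {k..Suc i})"
        using step.prems step.hyps by auto
      then have "(\<Prod>l\<in>{..<n} - {k..i}. w - z l) = (w - ?z) * (\<Prod>l\<in>{..<n} - {k..Suc i}. w - z l)"
        using step.hyps by simp
      then show ?thesis
        using step.hyps by (simp add: R_def Suc_diff_le)
    qed
    finally show "(w - ?z) * L (\<lambda>\<zeta>. p k (Suc i) \<zeta> * kernel w \<zeta>) = (w - ?z) * R (Suc i) w" .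
  qed (use step.prems z_ball in auto)
  then show ?case by (simp add: R_def)
qed

lemma L_p_same: "k < n \<Longrightarrow> L (p k k) = - 1 / z k"
  using h_eq[OF z_ball, of k] h_z[of k] z_nz[of k]
  by (simp add: p_same field_simps eq_neg_iff_add_eq_0 add.commute)

text \<open>\<open>p k i\<close> is \<open>p k (i - 1)\<close> times \<open>kernel w\<close> at
  \<open>w = z i\<close>, and the factor \<open>w - z i\<close> is still present in the formula for
  \<open>L\<close>.\<close>

lemma L_p_less:
  assumes "k < i" "i < n"
  shows "L (p k i) = 0"
proof -
  obtain j where j: "i = Suc j" "k \<le> j"
    using assms(1) by (metis less_Suc_eq_le lessE less_imp_le_nat less_or_eq_imp_le)
  have "p k i = (\<lambda>\<zeta>. p k j \<zeta> * kernel (z i) \<zeta>)"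
    using j by (simp add: p_Suc fun_eq_iff)
  then have "L (p k i) = z i ^ (j - k) * (\<Prod>l\<in>{..<n} - {k..j}. z i - z l) * g (z i)"
    using L_p_kernel[of k j "z i"] j assms z_ball by simp
  also have "(\<Prod>l\<in>{..<n} - {k..j}. z i - z l) = 0"
    using j assms by (intro prod_zero bexI[of _ i]) auto
  finally show ?thesis by simp
qed

text \<open>A null combination is annihilated by \<open>L\<close> even after multiplication with a
  continuous function. Multiplying by the denominators \<open>?Q\<close> of the first
  \<open>k\<close> kernels turns \<open>p 0 i\<close> into \<open>p k i\<close> for
  \<open>i \<ge> k\<close>, and \<open>L (p k i) = 0\<close> for \<open>i > k\<close> isolates
  \<open>d k\<close>. So all coefficients vanish, contradicting the leading 1.\<close>

lemma p_independent:
  assumes j: "j < n"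
  shows "sqnorm (\<lambda>x. p 0 j x + (\<Sum>i<j. c i * p 0 i x)) \<noteq> 0"
proof
  assume null: "sqnorm (\<lambda>x. p 0 j x + (\<Sum>i<j. c i * p 0 i x)) = 0"
  define d where "d i = (if i = j then 1 else c i)" for i
  define f where "f = (\<lambda>x. p 0 j x + (\<Sum>i<j. c i * p 0 i x))"
  have f: "cont_circle f"
    unfolding f_def by (intro continuous_intros)
  have f_eq: "f x = (\<Sum>i\<le>j. d i * p 0 i x)" for x
    by (simp add: f_def d_def lessThan_Suc_atMost[symmetric])
  have "k \<le> j \<longrightarrow> d k = 0" for k
  proof (induction k rule: less_induct)
    case (less k)
    show ?case
    proof
      assume k: "k \<le> j"
      let ?Q = "\<lambda>x. \<Prod>l<k. 1 - z l * cnj x"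
      have "0 = L (\<lambda>x. ?Q x * f x)"
        by (rule L_null[symmetric]) (use null f in \<open>auto simp: f_def intro!: continuous_intros\<close>)
      also have "\<dots> = L (\<lambda>x. \<Sum>i\<in>{k..j}. d i * p k i x)"
      proof (intro L_cong continuous_intros f)
        fix x :: complex assume x: "norm x = 1"
        have "f x = (\<Sum>i\<in>{k..j}. d i * p 0 i x)"
          unfolding f_eq using less k by (intro sum.mono_neutral_right) auto
        then have "?Q x * f x = (\<Sum>i\<in>{k..j}. d i * (?Q x * p 0 i x))"
          by (simp add: sum_distrib_left mult_ac)
        also have "\<dots> = (\<Sum>i\<in>{k..j}. d i * p k i x)"
        proof (intro sum.cong refl arg_cong2[where f = "(*)"])
          fix i assume i: "i \<in> {k..j}"
          have "{0..i} = {..<k} \<union> {k..i}"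
            using i by auto
          then have "p 0 i x = (\<Prod>l<k. kernel (z l) x) * p k i x"
            unfolding p_def by (simp add: prod.union_disjoint ivl_disj_int)
          moreover have "?Q x * (\<Prod>l<k. kernel (z l) x) = 1"
            using kernel_denom_nz[OF z_ball x]
            by (simp add: kernel_def flip: prod.distrib)
          ultimately show "?Q x * p 0 i x = p k i x"
            by (simp flip: mult.assoc)
        qed
        finally show "?Q x * f x = (\<Sum>i\<in>{k..j}. d i * p k i x)" .
      qed
      also have "\<dots> = (\<Sum>i\<in>{k..j}. d i * L (p k i))"
        by (intro L_sum continuous_intros)
      also have "\<dots> = (\<Sum>i\<in>{k..j}. if i = k then d k * (- 1 / z k) else 0)"
        using j k L_p_same L_p_less by (intro sum.cong refl) auto
      also have "\<dots> = d k * (- 1 / z k)"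
        using k by simp
      finally show "d k = 0"
        using z_nz[of k] j k by simp
    qed
  qed
  from this[of j] show False
    by (simp add: d_def)
qed

end

section \<open>The zero estimate\<close>

context perturbed_zeros
begin

text \<open>With respect to the \<open>p 0 i\<close>, the operator \<open>T\<close> is bidiagonal
  with diagonal entries \<open>1 / z i\<close>. For \<open>i = 0\<close> the predecessor would be
  the constant 1, and \<open>L (p 0 0) = - 1 / z 0\<close> cancels it; for larger \<open>i\<close>
  the functional vanishes.\<close>

lemma shift_minus_L_p:
  assumes i: "i < n" and x: "norm x = 1"
  shows "cnj x * p 0 i x - L (p 0 i) = (p 0 i x - (if i = 0 then 0 else p 0 (i - 1) x)) / z i"
proof (cases i)
  case 0
  with i L_p_same[of 0] cnj_times_kernel[OF z_ball x z_nz[OF i]] show ?thesis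
    by (simp add: p_same diff_divide_distrib)
next
  case (Suc k)
  have "cnj x * p 0 i x = p 0 k x * (cnj x * kernel (z i) x)"
    using Suc by (simp add: p_Suc mult_ac)
  also have "\<dots> = (p 0 i x - p 0 k x) / z i"
    using Suc unfolding cnj_times_kernel[OF z_ball x z_nz[OF i]] by (simp add: p_Suc algebra_simps)
  finally show ?thesis
    using Suc L_p_less[of 0 i] i by simp
qed

lemma sum_zeros_le: "(\<Sum>j<n. 1 / norm (z j) - 1) \<le> mass"
proof -
  have "\<forall>j. \<exists>c. j < n \<longrightarrow> (\<forall>k<j. ip (p 0 k) (\<lambda>x. p 0 j x + (\<Sum>i<j. c i * p 0 i x)) = 0)"
    by (intro allI, case_tac "j < n") (auto intro!: ex_orthogonal p_independent cont_circle_p)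
  then obtain c where c: "\<And>j k. j < n \<Longrightarrow> k < j \<Longrightarrow>
      ip (p 0 k) (\<lambda>x. p 0 j x + (\<Sum>i<j. c j i * p 0 i x)) = 0"
    by metis
  define u where "u j = (\<lambda>x. p 0 j x + (\<Sum>i<j. c j i * p 0 i x))" for j
  define N where "N j = sqnorm (u j)" for j
  have u [continuous_intros]: "cont_circle (u j)" for j
    unfolding u_def by (intro continuous_intros)
  have Nnz: "N j \<noteq> 0" if "j < n" for j
    using p_independent[OF that] by (simp add: N_def u_def)
  then have Npos: "0 < N j" if "j < n" for j
    using that sqnorm_nonneg[of "u j"] by (simp add: N_def order_less_le)
  have ip_p: "ip (p 0 k) (u j) = 0" if "j < n" "k < j" for j k
    using c[OF that] by (simp add: u_def)
  have ip_u: "ip (u i) f = ip (p 0 i) f + (\<Sum>k<i. c i k * ip (p 0 k) f)" if "cont_circle f" for i f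
    unfolding u_def by (subst ip_add) (auto intro!: continuous_intros that simp: ip_sum cont_circle_p that)
  have orth_less: "ip (u i) (u j) = 0" if "j < n" "i < j" for i j
    using that by (simp add: ip_u u ip_p)
  have orth: "ip (u i) (u j) = 0" if "i < n" "j < n" "i \<noteq> j" for i j
    using that orth_less[of i j] orth_less[of j i] cnj_ip[of "u i" "u j"]
    by (metis complex_cnj_zero_iff nat_neq_iff)
  have diag: "ip (p 0 j) (u j) = complex_of_real (N j)" if "j < n" for j
    using that ip_u[of "u j" j] by (simp add: u ip_p ip_same N_def)
  define \<Lambda> where "\<Lambda> f = (LINT x|m. f x)" for f :: "complex \<Rightarrow> complex"
  \<comment> \<open>\<open>cnj (\<Lambda> (u j))\<close> is the inner product of 1 with
    \<open>u j\<close>. Since \<open>T (u j)\<close> is \<open>u j / z j\<close> plus a combination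
    of earlier \<open>p 0 i\<close>, to which \<open>u j\<close> is orthogonal, pairing with
    \<open>u j\<close> leaves only the diagonal entry.\<close>
  have key: "complex_of_real (N j) / z j = ip (\<lambda>x. cnj x * u j x) (u j) - L (u j) * cnj (\<Lambda> (u j))"
    if j: "j < n" for j
  proof -
    define d where "d i = (if i = j then 1 else c j i)" for i
    define q where "q i = (\<lambda>x. p 0 i x - (if i = 0 then 0 else p 0 (i - 1) x))" for i
    have q [continuous_intros]: "cont_circle (q i)" for i
      unfolding q_def by (cases "i = 0") (auto intro!: continuous_intros)
    have u_eq: "u j = (\<lambda>x. \<Sum>i\<le>j. d i * p 0 i x)"
      by (rule ext) (simp add: u_def d_def lessThan_Suc_atMost[symmetric])
    have L_u: "L (u j) = (\<Sum>i\<le>j. d i * L (p 0 i))"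
      unfolding u_eq by (intro L_sum continuous_intros)
    have ip_q: "ip (q i) (u j) = (if i = j then complex_of_real (N j) else 0)" if "i \<le> j" for i
    proof -
      have "ip (q i) (u j) = ip (p 0 i) (u j) - (if i = 0 then 0 else ip (p 0 (i - 1)) (u j))"
        by (cases "i = 0") (simp_all add: q_def ip_diff continuous_intros)
      then show ?thesis
        using that j by (auto simp: ip_p diag)
    qed
    have "ip (\<lambda>x. cnj x * u j x) (u j) - L (u j) * cnj (\<Lambda> (u j))
        = ip (\<lambda>x. cnj x * u j x) (u j) - ip (\<lambda>x. L (u j) * 1) (u j)"
      unfolding ip_cmult by (simp add: ip_def \<Lambda>_def)
    also have "\<dots> = ip (\<lambda>x. cnj x * u j x - L (u j) * 1) (u j)"
      by (intro ip_diff[symmetric] continuous_intros)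
    also have "\<dots> = ip (\<lambda>x. \<Sum>i\<le>j. (d i / z i) * q i x) (u j)"
    proof (rule ip_cong)
      fix x :: complex assume x: "norm x = 1"
      have "cnj x * u j x - L (u j) * 1 = (\<Sum>i\<le>j. d i * (cnj x * p 0 i x - L (p 0 i)))"
        unfolding L_u by (subst u_eq) (simp add: sum_distrib_left sum_subtractf algebra_simps)
      also have "\<dots> = (\<Sum>i\<le>j. (d i / z i) * q i x)"
        using j x by (intro sum.cong refl) (simp add: shift_minus_L_p q_def)
      finally show "cnj x * u j x - L (u j) * 1 = (\<Sum>i\<le>j. (d i / z i) * q i x)" .
    qed
    also have "\<dots> = (\<Sum>i\<le>j. (d i / z i) * ip (q i) (u j))"
      by (intro ip_sum continuous_intros)
    also have "\<dots> = (\<Sum>i\<le>j. if i = j then complex_of_real (N j) / z j else 0)"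
      by (intro sum.cong refl) (auto simp: ip_q d_def)
    finally show ?thesis by simp
  qed
  \<comment> \<open>Multiplication by \<open>cnj x\<close> has modulus 1 on the circle; after
    division by \<open>N j\<close> this bound becomes the 1 subtracted in the claim.\<close>
  have shift_le: "norm (ip (\<lambda>x. cnj x * u j x) (u j)) \<le> N j" for j
  proof -
    have "norm (ip (\<lambda>x. cnj x * u j x) (u j)) \<le> (LINT x|m. norm (cnj x * u j x * cnj (u j x)))"
      unfolding ip_def by (rule integral_norm_bound)
    also have "\<dots> = N j"
      unfolding N_def sqnorm_def by (intro LINT_cong) (simp add: norm_mult power2_eq_square)
    finally show ?thesis .
  qed
  \<comment> \<open>The factor \<open>1 / N j\<close> is split evenly, so that \<open>a j\<close>
    and \<open>b j\<close> are the moduli of the two functionals on the normalised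
    \<open>u j\<close>.\<close>
  define a where "a j = norm (L (u j)) / sqrt (N j)" for j
  define b where "b j = norm (\<Lambda> (u j)) / sqrt (N j)" for j
  have "1 / norm (z j) - 1 \<le> \<bar>a j\<bar> * \<bar>b j\<bar>" if j: "j < n" for j
  proof -
    have "N j / norm (z j) = norm (complex_of_real (N j) / z j)"
      using Npos[OF j] by (simp add: norm_divide)
    also have "\<dots> \<le> N j + norm (L (u j)) * norm (\<Lambda> (u j))"
      unfolding key[OF j]
      by (rule order_trans[OF norm_triangle_ineq4]) (use shift_le[of j] in \<open>simp add: norm_mult\<close>)
    finally have "N j / norm (z j) / N j \<le> (N j + norm (L (u j)) * norm (\<Lambda> (u j))) / N j"
      using Npos[OF j] by (intro divide_right_mono) auto
    then show ?thesis
      using Npos[OF j] by (simp add: a_def b_def add_divide_distrib)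
  qed
  then have "(\<Sum>j<n. 1 / norm (z j) - 1) \<le> (\<Sum>j<n. \<bar>a j\<bar> * \<bar>b j\<bar>)"
    by (intro sum_mono) auto
  also have "\<dots> \<le> L2_set a {..<n} * L2_set b {..<n}"
    by (rule L2_set_mult_ineq)
  also have "\<dots> \<le> sqrt mass * sqrt mass"
  proof (intro mult_mono)
    have "(\<Sum>j<n. (norm (L (u j)))\<^sup>2 / sqnorm (u j)) \<le> mass"
      by (rule Bessel_dominated)
        (auto intro!: L_sum L_le continuous_intros simp: orth Nnz[unfolded N_def])
    then show "L2_set a {..<n} \<le> sqrt mass"
      unfolding L2_set_def a_def power_divide
      by (intro real_sqrt_le_mono) (simp add: N_def sqnorm_nonneg)
    have "(\<Sum>j<n. (norm (\<Lambda> (u j)))\<^sup>2 / sqnorm (u j)) \<le> mass"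
    proof (rule Bessel_dominated)
      show "\<Lambda> (\<lambda>x. \<Sum>j<n. c j * u j x) = (\<Sum>j<n. c j * \<Lambda> (u j))" for c
        unfolding \<Lambda>_def by (subst Bochner_Integration.integral_sum)
          (auto intro!: integrable_cont continuous_intros)
      show "norm (\<Lambda> f) \<le> (LINT x|m. norm (f x))" for f
        unfolding \<Lambda>_def by (rule integral_norm_bound)
    qed (auto intro!: continuous_intros simp: orth Nnz[unfolded N_def])
    then show "L2_set b {..<n} \<le> sqrt mass"
      unfolding L2_set_def b_def power_divide
      by (intro real_sqrt_le_mono) (simp add: N_def sqnorm_nonneg)
  qed auto
  finally show ?thesis by simp
qed

end

section \<open>Splitting off zeros with multiplicity\<close>

lemma holomorphic_factor_zorder:
  assumes g: "g holomorphic_on S" and S: "open S" "connected S" "z \<in> S" and nz: "\<exists>w\<in>S. g w \<noteq> 0"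
  obtains G where "G holomorphic_on S" "\<And>w. w \<in> S \<Longrightarrow> g w = (w - z) ^ nat (zorder g z) * G w"
proof -
  define k where "k = nat (zorder g z)"
  obtain r where r: "r > 0" "cball z r \<subseteq> S" "zor_poly g z holomorphic_on cball z r"
      "\<And>w. w \<in> cball z r \<Longrightarrow> g w = zor_poly g z w * (w - z) ^ k"
    using zorder_exist_zero[OF g S nz] unfolding k_def by metis
  \<comment> \<open>Near \<open>z\<close> this agrees with the holomorphic
    \<open>zor_poly g z\<close>, away from \<open>z\<close> it is a quotient; the two regions cover
    \<open>S\<close>.\<close>
  define G where "G w = (if w = z then zor_poly g z z else g w / (w - z) ^ k)" for w
  have "G holomorphic_on ball z r"
  proof (rule holomorphic_transform)
    show "zor_poly g z holomorphic_on ball z r"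
      using r(3) by (rule holomorphic_on_subset) auto
    show "zor_poly g z w = G w" if "w \<in> ball z r" for w
      using r(4)[of w] that by (auto simp: G_def)
  qed
  moreover have "G holomorphic_on S - {z}"
  proof (rule holomorphic_transform)
    show "(\<lambda>w. g w / (w - z) ^ k) holomorphic_on S - {z}"
      by (intro holomorphic_intros holomorphic_on_subset[OF g]) auto
  qed (auto simp: G_def)
  ultimately have "G holomorphic_on ball z r \<union> (S - {z})"
    using S by (intro holomorphic_on_Un) (auto simp: open_delete)
  moreover have "ball z r \<union> (S - {z}) = S"
    using r(1,2) S(3) by (auto simp: subset_iff)
  moreover have "g w = (w - z) ^ k * G w" if "w \<in> S" for w
    using r(4)[of z] r(1) by (auto simp: G_def)
  ultimately show ?thesis
    using that[of G] by (simp add: k_def)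
qed

text \<open>Zeros are split off one by one. The factor \<open>P\<close> already removed does not
  vanish at the new point \<open>z\<close>, so the order of the remaining \<open>g\<close> at
  \<open>z\<close> is that of \<open>h\<close>.\<close>

lemma holomorphic_factor_zeros:
  assumes h: "h holomorphic_on S" and S: "open S" "connected S" and nz: "\<exists>w\<in>S. h w \<noteq> 0"
    and F: "finite F" "F \<subseteq> S"
  shows "\<exists>g. g holomorphic_on S \<and> (\<forall>w\<in>S. h w = (\<Prod>z\<in>F. (w - z) ^ nat (zorder h z)) * g w)"
  using F
proof (induction F rule: finite_induct)
  case empty
  then show ?case using h by auto
next
  case (insert z F)
  define P where "P w = (\<Prod>z\<in>F. (w - z) ^ nat (zorder h z))" for w
  obtain g where g: "g holomorphic_on S" "\<And>w. w \<in> S \<Longrightarrow> h w = P w * g w"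
    using insert.IH insert.prems unfolding P_def by auto
  have z: "z \<in> S"
    using insert.prems by simp
  have P_hol: "P holomorphic_on UNIV"
    unfolding P_def by (intro holomorphic_intros)
  then have P_ana: "P analytic_on {z}"
    by (simp add: analytic_on_holomorphic) (metis UNIV_I open_UNIV)
  have g_ana: "g analytic_on {z}"
    using g(1) S(1) z analytic_at by blast
  have Pz: "P z \<noteq> 0"
    using insert.hyps by (auto simp: P_def)
  \<comment> \<open>Zeros of \<open>h\<close> are isolated. Additivity of \<open>zorder\<close> is
    applied to a product that does not vanish in a punctured neighbourhood of
    \<open>z\<close>.\<close>
  have "eventually (\<lambda>w. w \<in> S \<and> w \<noteq> z \<and> h w \<noteq> 0) (at z)"
  proof -
    obtain w0 where "w0 \<in> S" "h w0 \<noteq> 0" using nz by blast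
    then have "eventually (\<lambda>w. h w \<noteq> 0 \<and> w \<in> S) (at z)"
      using non_zero_neighbour_alt[OF h S z] by blast
    moreover have "eventually (\<lambda>w. w \<noteq> z) (at z)"
      by (simp add: eventually_at_filter)
    ultimately show ?thesis by eventually_elim auto
  qed
  then have ev: "eventually (\<lambda>w. P w * g w \<noteq> 0) (at z)"
    by eventually_elim (auto simp: g(2))
  have "zorder h z = zorder (\<lambda>w. P w * g w) z"
  proof (rule zorder_cong)
    have "eventually (\<lambda>w. w \<in> S) (at z)"
      using S(1) z by (intro eventually_at_in_open')
    then show "eventually (\<lambda>w. h w = P w * g w) (at z)"
      by eventually_elim (rule g(2))
  qed simp
  also have "\<dots> = zorder P z + zorder g z"
    by (rule zorder_times_analytic[OF P_ana g_ana ev])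
  also have "zorder P z = 0"
    by (rule zorder_eq_0I[OF P_ana Pz])
  finally have ord: "zorder g z = zorder h z" by simp
  have "\<exists>w\<in>S. g w \<noteq> 0"
    using nz g(2) by (metis mult_zero_right)
  then obtain G where G: "G holomorphic_on S" "\<And>w. w \<in> S \<Longrightarrow> g w = (w - z) ^ nat (zorder g z) * G w"
    using holomorphic_factor_zorder[OF g(1) S z] by blast
  show ?case
    using G g(2) insert.hyps
    by (intro exI[of _ G]) (simp add: ord P_def mult_ac)
qed

text \<open>Each point is repeated \<open>k x\<close> times. One list serves for all
  \<open>f\<close>, as it has to match both the factorisation of \<open>h\<close> and the sum over
  its zeros.\<close>

lemma ex_list_with_multiplicities:
  fixes k :: "'a \<Rightarrow> nat"
  assumes "finite F"
  shows "\<exists>xs. set xs \<subseteq> F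
    \<and> (\<forall>f :: 'a \<Rightarrow> complex. prod_list (map f xs) = (\<Prod>x\<in>F. f x ^ k x))
    \<and> (\<forall>f :: 'a \<Rightarrow> real. sum_list (map f xs) = (\<Sum>x\<in>F. real (k x) * f x))"
  using assms
proof (induction F rule: finite_induct)
  case (insert x F)
  then obtain xs where xs: "set xs \<subseteq> F"
    "\<forall>f :: 'a \<Rightarrow> complex. prod_list (map f xs) = (\<Prod>x\<in>F. f x ^ k x)"
    "\<forall>f :: 'a \<Rightarrow> real. sum_list (map f xs) = (\<Sum>x\<in>F. real (k x) * f x)"
    by blast
  have "set (replicate (k x) x @ xs) \<subseteq> insert x F"
    using xs(1) by auto
  with xs insert.hyps show ?case
    by (intro exI[of _ "replicate (k x) x @ xs"]) (simp add: prod_list_replicate sum_list_replicate)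
qed simp

section \<open>From a representing measure to the estimate\<close>

lemma dominated_functional_complex_measure:
  assumes "complex_measure circle_borel \<mu>" "total_variation circle_borel \<mu> < \<infinity>"
  shows "dominated_functional (complex_measure_integral circle_borel \<mu>) (variation_measure circle_borel \<mu>)"
proof -
  interpret finite_complex_measure circle_borel \<mu>
    by standard (fact assms)+
  have bm: "f \<in> bounded_measurable circle_borel" if f: "cont_circle f" for f
  proof -
    have "f \<in> borel_measurable circle_borel"
      unfolding circle_borel_def by (rule borel_measurable_continuous_on_restrict[OF f])
    moreover obtain B where "\<And>x. norm x = 1 \<Longrightarrow> norm (f x) \<le> B"
      using cont_circle_bounded[OF f] by blast
    then have "\<forall>x\<in>space circle_borel. norm (f x) \<le> B"
      by (simp add: circle_borel_def space_restrict_space)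
    ultimately show ?thesis
      by (auto simp: bounded_measurable_def)
  qed
  show ?thesis
    by (rule dominated_functional.intro)
      (rule variation.finite_measure_axioms sets_variation_measure cintegral_add cintegral_cmult
        norm_cintegral_le bm | assumption)+
qed

theorem theorem3:
  fixes h :: "complex \<Rightarrow> complex"
  assumes "h \<in> cauchy_transforms"
    and "h 0 = 1"
  shows "(\<Sum>\<^sub>\<infinity>z\<in>disk_zeros h. ennreal (of_int (zorder h z) * (1 / norm z - 1)))
           \<le> cauchy_norm (backward_shift h)"
  unfolding cauchy_norm_def
proof (rule INF_greatest)
  fix \<mu> assume "\<mu> \<in> representing_measures (backward_shift h)"
  then have \<mu>: "complex_measure circle_borel \<mu>"
    and rep: "\<And>w. norm w < 1 \<Longrightarrow> cauchy_transform \<mu> w = backward_shift h w"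
    by (auto simp: representing_measures_def)
  let ?t = "\<lambda>z. real_of_int (zorder h z) * (1 / norm z - 1)"
  show "(\<Sum>\<^sub>\<infinity>z\<in>disk_zeros h. ennreal (?t z)) \<le> total_variation circle_borel \<mu>"
  proof (cases "total_variation circle_borel \<mu> < \<infinity>")
    case True
    interpret finite_complex_measure circle_borel \<mu>
      by standard (fact \<mu> True)+
    interpret dominated_functional "complex_measure_integral circle_borel \<mu>"
        "variation_measure circle_borel \<mu>"
      by (rule dominated_functional_complex_measure[OF \<mu> True])
    have hol: "h holomorphic_on ball 0 1"
      using assms(1) by (simp add: cauchy_transforms_def)
    \<comment> \<open>The definition of the backward shift solved for \<open>h w\<close>; at
      \<open>w = 0\<close> the claim is just the normalisation \<open>h 0 = 1\<close>.\<close>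
    have h_eq: "h w = 1 + w * cintegral (kernel w)" if "norm w < 1" for w
      using rep[OF that] assms(2)
      by (cases "w = 0") (simp_all add: cauchy_transform_def backward_shift_def kernel_def[abs_def])
    \<comment> \<open>Finite sets of zeros suffice: a nonnegative sum is the supremum of its finite
      partial sums.\<close>
    have bound: "(\<Sum>z\<in>F. ennreal (?t z)) \<le> total_variation circle_borel \<mu>"
      if F: "finite F" "F \<subseteq> disk_zeros h" for F
    proof -
      have nz: "\<exists>w\<in>ball 0 1. h w \<noteq> 0"
        using assms(2) by (intro bexI[of _ 0]) auto
      have ord: "zorder h z \<ge> 0" if "z \<in> ball 0 1" for z
        using zorder_exist_zero[OF hol open_ball connected_ball that nz]
        by (auto split: if_splits)
      obtain g where g: "g holomorphic_on ball 0 1"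
        "\<And>w. w \<in> ball 0 1 \<Longrightarrow> h w = (\<Prod>z\<in>F. (w - z) ^ nat (zorder h z)) * g w"
        using holomorphic_factor_zeros[OF hol open_ball connected_ball nz F(1)] F(2)
        by (auto simp only: disk_zeros_def)
      obtain xs where xs: "set xs \<subseteq> F"
        "\<And>f :: complex \<Rightarrow> complex. prod_list (map f xs) = (\<Prod>z\<in>F. f z ^ nat (zorder h z))"
        "\<And>f :: complex \<Rightarrow> real. sum_list (map f xs) = (\<Sum>z\<in>F. real (nat (zorder h z)) * f z)"
        using ex_list_with_multiplicities[OF F(1), of "\<lambda>z. nat (zorder h z)"] by blast
      \<comment> \<open>The default 0 beyond the list is a point of the disk, as
        \<open>z_ball\<close> demands for every index.\<close>
      define z where "z i = (if i < length xs then xs ! i else 0)" for i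
      have in_F: "x \<in> ball 0 1" if "x \<in> F" for x
        using that F(2) by (auto simp: disk_zeros_def)
      interpret perturbed_zeros "complex_measure_integral circle_borel \<mu>"
          "variation_measure circle_borel \<mu>" h g z "length xs"
      proof
        show "norm (z i) < 1" for i
          using xs(1) in_F[of "xs ! i"] by (auto simp: z_def subset_iff)
        show "h w = (\<Prod>i<length xs. w - z i) * g w" if "norm w < 1" for w
        proof -
          have "(\<Prod>i<length xs. w - z i) = prod_list (map (\<lambda>x. w - x) xs)"
            unfolding prod.list_conv_set_nth length_map atLeast0LessThan
            by (intro prod.cong) (simp_all add: z_def)
          then show ?thesis
            using g(2)[of w] that xs(2)[of "\<lambda>x. w - x"] by simp
        qed
      qed (use h_eq g(1) in \<open>auto intro: holomorphic_on_imp_continuous_on\<close>)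
      have "(\<Sum>z\<in>F. ennreal (?t z)) = ennreal (\<Sum>z\<in>F. ?t z)"
      proof (rule sum_ennreal)
        fix x assume x: "x \<in> F"
        \<comment> \<open>With \<open>1 / 0 = 0\<close> the term of a zero at the origin would be
          negative; \<open>h 0 = 1\<close> excludes such a zero.\<close>
        then have "x \<noteq> 0" "norm x < 1"
          using F(2) assms(2) by (auto simp: disk_zeros_def)
        then show "0 \<le> ?t x"
          using ord[OF in_F[OF x]] by simp
      qed
      also have "(\<Sum>z\<in>F. ?t z) = sum_list (map (\<lambda>x. 1 / norm x - 1) xs)"
        unfolding xs(3) by (intro sum.cong refl) (simp add: ord[OF in_F])
      also have "\<dots> = (\<Sum>i<length xs. 1 / norm (z i) - 1)"
        unfolding sum_list_sum_nth length_map atLeast0LessThan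
        by (intro sum.cong) (simp_all add: z_def)
      also have "ennreal \<dots> \<le> ennreal (measure (variation_measure circle_borel \<mu>)
          (space (variation_measure circle_borel \<mu>)))"
        by (intro ennreal_leI sum_zeros_le)
      also have "\<dots> \<le> total_variation circle_borel \<mu>"
        using measure_variation_le by simp
      finally show ?thesis .
    qed
    have "(\<Sum>\<^sub>\<infinity>z\<in>disk_zeros h. ennreal (?t z))
        = (SUP F\<in>{F. finite F \<and> F \<subseteq> disk_zeros h}. \<Sum>z\<in>F. ennreal (?t z))"
      by (rule nonneg_infsum_complete) simp
    also have "\<dots> \<le> total_variation circle_borel \<mu>"
      by (rule SUP_least) (use bound in auto)
    finally show ?thesis .
  qed (auto simp: not_less top_unique)
qed

end
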